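(* Fix $\lambda\in\mathbb{R}$. Let $f\in C^\infty(\mathbb{C}^n)$ be such that $L_\lambda^m f\in L^2(\mathbb{C}^n)$ for all integers $m\ge0$ and $$\sum_{m=1}^\infty \|L_\lambda^m f\|_2^{-\frac1{2m}}=\infty .$$ If $f$ and all its partial derivatives vanish at some point $w\in\mathbb{C}^n$, then $f$ is identically zero.
   Context: For $\lambda\in\mathbb{R}$, $L_\lambda$ is the special Hermite operator on $\mathbb{C}^n$ (identified with $\mathbb{R}^{2n}$ via $z=x+iy$), explicitly $$L_\lambda=-\Delta_{\mathbb{C}^n}+\tfrac14\lambda^2|z|^2+i\lambda N,\qquad N=\sum_{j=1}^n\Big(x_j\frac{\partial}{\partial y_j}-y_j\frac{\partial}{\partial x_j}\Big),$$ where $\Delta_{\mathbb{C}^n}=\sum_{j=1}^n\big(\partial_{x_j}^2+\partial_{y_j}^2\big)$. Equivalently, $\mathcal{L}(f(z)e^{i\lambda t})=e^{i\lambda t}L_\lambda f(z)$, where $\mathcal{L}=-\sum_{j=1}^n(X_j^2+Y_j^2)$ is the sublaplacian on the Heisenberg group $\mathbb{C}^n\times\mathbb{R}$, with $X_j=\partial_{x_j}+\tfrac12y_j\partial_t$ and $Y_j=\partial_{y_j}-\tfrac12x_j\partial_t$. $\|\cdot\|_2$ is the norm of $L^2(\mathbb{C}^n)$ with respect to Lebesgue measure; partial derivatives are with respect to the real coordinates (of all orders). *)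

theory Defs
  imports "HOL-Analysis.Analysis"
begin

(* Real partial derivative along v. For v in Basis of complex ^ 'n, whose elements are
   axis j 1 and axis j \<i>, these are the derivatives in x_j and y_j, where z_j = x_j + i y_j. *)
definition partial_deriv ::
    "'a::euclidean_space \<Rightarrow> ('a \<Rightarrow> 'b::real_normed_vector) \<Rightarrow> 'a \<Rightarrow> 'b" where
  "partial_deriv v f z = vector_derivative (\<lambda>t. f (z + t *\<^sub>R v)) (at 0)"

definition iterated_partial ::
    "'a::euclidean_space list \<Rightarrow> ('a \<Rightarrow> 'b::real_normed_vector) \<Rightarrow> 'a \<Rightarrow> 'b" where
  "iterated_partial vs f = foldr partial_deriv vs f"

(* Since vector_derivative is total, the existence of each derivative is demanded explicitly. *)
definition smooth :: "('a::euclidean_space \<Rightarrow> 'b::real_normed_vector) \<Rightarrow> bool" where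
  "smooth f \<longleftrightarrow>
     (\<forall>vs. set vs \<subseteq> Basis \<longrightarrow>
        continuous_on UNIV (iterated_partial vs f) \<and>
        (\<forall>v\<in>Basis. \<forall>z. (\<lambda>t. iterated_partial vs f (z + t *\<^sub>R v)) differentiable (at 0)))"

definition partial_x :: "'n::finite \<Rightarrow> (complex ^ 'n \<Rightarrow> complex) \<Rightarrow> complex ^ 'n \<Rightarrow> complex" where
  "partial_x j = partial_deriv (axis j 1)"

definition partial_y :: "'n::finite \<Rightarrow> (complex ^ 'n \<Rightarrow> complex) \<Rightarrow> complex ^ 'n \<Rightarrow> complex" where
  "partial_y j = partial_deriv (axis j \<i>)"

definition laplacian :: "(complex ^ 'n::finite \<Rightarrow> complex) \<Rightarrow> complex ^ 'n \<Rightarrow> complex" where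
  "laplacian f z =
     (\<Sum>j\<in>UNIV. partial_x j (partial_x j f) z + partial_y j (partial_y j f) z)"

definition rotation_field :: "(complex ^ 'n::finite \<Rightarrow> complex) \<Rightarrow> complex ^ 'n \<Rightarrow> complex" where
  "rotation_field f z =
     (\<Sum>j\<in>UNIV. of_real (Re (z $ j)) * partial_y j f z - of_real (Im (z $ j)) * partial_x j f z)"

definition special_hermite ::
    "real \<Rightarrow> (complex ^ 'n::finite \<Rightarrow> complex) \<Rightarrow> complex ^ 'n \<Rightarrow> complex" where
  "special_hermite l f z =
     - laplacian f z + of_real (l\<^sup>2 * (norm z)\<^sup>2 / 4) * f z + \<i> * of_real l * rotation_field f z"

definition in_L2 :: "('a::euclidean_space \<Rightarrow> complex) \<Rightarrow> bool" where
  "in_L2 f \<longleftrightarrow> f \<in> borel_measurable lebesgue \<and> integrable lebesgue (\<lambda>z. (cmod (f z))\<^sup>2)"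

definition L2_norm :: "('a::euclidean_space \<Rightarrow> complex) \<Rightarrow> real" where
  "L2_norm f = sqrt (LINT z|lebesgue. (cmod (f z))\<^sup>2)"

(* ||L^m f||_2 powr (-1/(2m)) in [0, \<infinity>], for m \<ge> 1. The inverse is taken in ennreal
   so that the value is \<infinity> if the norm is 0; in the reals, 0 powr (-a) would be 0. *)
definition carleman_term ::
    "real \<Rightarrow> (complex ^ 'n::finite \<Rightarrow> complex) \<Rightarrow> nat \<Rightarrow> ennreal" where
  "carleman_term l f m =
     inverse (ennreal (L2_norm ((special_hermite l ^^ m) f) powr (1 / (2 * real m))))"

end

theory Submission
  imports Defs
begin

text \<open>The operator is minus the sum of the squares of the magnetic derivatives
  \<open>D\<^sub>b = \<partial>\<^sub>b + \<i> (z \<bullet> K b)\<close>, one for each real coordinate direction \<open>b\<close>; these are the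
  Heisenberg fields \<open>X\<^sub>j\<close> and \<open>Y\<^sub>j\<close> acting on functions \<open>f(z) exp(\<i>\<lambda>t)\<close>. Their commutators are
  constants, and the proof rests on this alone. It is therefore carried out for an arbitrary such
  family on a Euclidean space; zero and nonzero \<open>\<lambda>\<close> are treated alike.

  The idea is to reduce the statement to the quasi-analyticity theorem on the real line. Along a
  line \<open>t \<mapsto> w + t b\<close> a phase factor of modulus one turns \<open>D\<^sub>b\<close> into \<open>d/dt\<close>
  (\<open>gauge_has_derivative\<close>). So if the sup norms of \<open>D\<^sub>b\<^sup>m f\<close> satisfy a Denjoy-Carleman condition and
  \<open>f\<close> is flat at \<open>w\<close>, then \<open>f\<close> vanishes on the line. The same holds for every iterated magnetic
  derivative of \<open>f\<close>, hence \<open>f\<close> is flat at each point of the line, and moving along one coordinate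
  direction after the other reaches every point. The one-dimensional theorem is proved by Bang's
  argument (\<open>bang_uniqueness\<close>), which follows how far a function can be from being flat as the point
  moves.

  The bounds on \<open>D\<^sub>b\<^sup>m f\<close> come from \<open>L\<^sup>2\<close> estimates. Write \<open>S\<^sub>m(g)\<close> for the \<open>L\<^sup>2\<close> norm of all magnetic
  derivatives of order \<open>m\<close>. Integration by parts gives \<open>S\<^sub>1(g)\<^sup>2 = \<langle>Lg, g\<rangle>\<close>, and since moving \<open>L\<close> past
  \<open>m\<close> derivatives produces \<open>m\<close> constant commutators, it gives
  \<open>S\<^bsub>m+2\<^esub>(g) \<le> S\<^sub>m(Lg) + c (m+1) S\<^sub>m(g)\<close> (\<open>sobolev_norm_two_steps\<close>). The numbers \<open>N\<^sub>k = \<parallel>L\<^sup>k f\<parallel>\<close> are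
  log-convex because \<open>L\<close> is symmetric; with their nondecreasing quotients \<open>r\<^sub>k = N\<^bsub>k+1\<^esub>/N\<^sub>k\<close> the
  recursion yields \<open>S\<^bsub>2k\<^esub>(f) \<le> C \<Prod> (r\<^sub>i + c (2i+1))\<close>, where the product is over \<open>i < k\<close>
  (\<open>geometric_mean_array_bound\<close>).
  Carleman's inequality turns the hypothesis on \<open>N\<^sub>k\<close> into \<open>\<Sum> r\<^sub>i\<^bsup>-1/2\<^esup> = \<infinity>\<close>, and as \<open>r\<close> is nondecreasing
  this divergence survives the linear perturbation of \<open>r\<^sub>i\<close> (\<open>not_summable_perturb\<close>). Finally a Sobolev
  inequality in each coordinate direction passes from \<open>L\<^sup>2\<close> to sup norms
  (\<open>magnetic_sobolev_embedding\<close>); it costs only a bounded number of extra derivatives, that is, a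
  shift of the sequence, which a divergent series does not notice.

  All integrations by parts need every magnetic derivative of \<open>L\<^sup>k f\<close> to be square integrable,
  while only the functions \<open>L\<^sup>k f\<close> themselves are given to be. This is an elliptic regularity statement
  (\<open>magnetic_elliptic_regularity\<close>), obtained from an energy estimate with a cutoff function.\<close>

section \<open>Carleman's inequality and log-convex sequences\<close>

text \<open>The plain inequality of arithmetic and geometric means loses a logarithm here. Weights
  \<open>c\<^sub>i\<close> with \<open>c\<^sub>0 \<cdots> c\<^sub>k = (k+2)\<^bsup>k+1\<^esup>\<close> make the two means comparable for slowly varying \<open>a\<close>, and
  then the arithmetic means can be summed by parts.\<close>
lemma carleman_inequality:
  fixes a :: "nat \<Rightarrow> real"
  assumes nonneg: "\<And>i. 0 \<le> a i" and sm: "summable a"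
  shows "summable (\<lambda>k. (\<Prod>i\<le>k. a i) powr (1 / real (Suc k)))"
proof -
  define c where "c i = real (i + 2) ^ (i + 1) / real (i + 1) ^ i" for i :: nat
  have c_pos: "0 < c i" for i by (simp add: c_def)
  have prod_c: "(\<Prod>i\<le>k. c i) = real (k + 2) ^ (k + 1)" for k
    by (induction k) (simp_all add: c_def)
  have c_le: "c i \<le> exp 1 * real (i + 1)" for i
  proof -
    have "1 + 1 / real (i + 1) = real (i + 2) / real (i + 1)" by (simp add: field_simps)
    then have "c i = real (i + 1) * (1 + 1 / real (i + 1)) ^ (i + 1)"
      by (simp add: c_def power_divide)
    also have "\<dots> \<le> real (i + 1) * exp 1"
      by (intro mult_left_mono exp_ge_one_plus_x_over_n_power_n) auto
    finally show ?thesis by (simp add: mult.commute)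
  qed
  define T where "T n = (\<Sum>i<n. a i * c i)" for n
  have T_nonneg: "0 \<le> T n" for n
    unfolding T_def using nonneg c_pos by (intro sum_nonneg mult_nonneg_nonneg) (auto intro: less_imp_le)
  \<comment> \<open>Summation by parts with \<open>1/((k+1)(k+2)) = 1/(k+1) - 1/(k+2)\<close>.\<close>
  have abel: "(\<Sum>k<n. T (Suc k) / (real (k + 1) * real (k + 2)))
      = (\<Sum>i<n. a i * c i / real (i + 1)) - T n / real (n + 1)" for n
  proof (induction n)
    case (Suc n)
    have "T (Suc n) / (real (n + 1) * real (n + 2)) = T (Suc n) / real (n + 1) - T (Suc n) / real (n + 2)"
      by (simp add: field_simps)
    moreover have "T (Suc n) / real (n + 1) = T n / real (n + 1) + a n * c n / real (n + 1)"
      by (simp add: T_def add_divide_distrib)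
    ultimately show ?case using Suc by simp
  qed (simp add: T_def)
  have term_le: "(\<Prod>i\<le>k. a i) powr (1 / real (Suc k)) \<le> T (Suc k) / (real (k + 1) * real (k + 2))" for k
  proof -
    have "(\<Prod>i\<le>k. a i * c i) powr (1 / real (card {..k})) \<le> (\<Sum>i\<le>k. a i * c i / real (card {..k}))"
      by (rule arith_geom_mean) (use nonneg c_pos in \<open>auto intro: mult_nonneg_nonneg less_imp_le\<close>)
    also have "\<dots> = T (Suc k) / real (k + 1)"
      by (simp add: T_def sum_divide_distrib lessThan_Suc_atMost)
    finally have le: "(\<Prod>i\<le>k. a i * c i) powr (1 / real (Suc k)) \<le> T (Suc k) / real (k + 1)"
      by simp
    have "(\<Prod>i\<le>k. a i * c i) powr (1 / real (Suc k))
        = (\<Prod>i\<le>k. a i) powr (1 / real (Suc k)) * (real (k + 2) ^ (k + 1)) powr (1 / real (Suc k))"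
      unfolding prod.distrib prod_c by (rule powr_mult)
    also have "(real (k + 2) ^ (k + 1)) powr (1 / real (Suc k)) = real (k + 2)"
      by (subst powr_realpow[symmetric]) (simp_all add: powr_powr)
    finally have eq: "(\<Prod>i\<le>k. a i * c i) powr (1 / real (Suc k))
        = (\<Prod>i\<le>k. a i) powr (1 / real (Suc k)) * real (k + 2)" .
    have "(\<Prod>i\<le>k. a i) powr (1 / real (Suc k))
        = (\<Prod>i\<le>k. a i * c i) powr (1 / real (Suc k)) / real (k + 2)" unfolding eq by simp
    also have "\<dots> \<le> T (Suc k) / real (k + 1) / real (k + 2)" by (intro divide_right_mono le) simp
    finally show ?thesis by simp
  qed
  show ?thesis
  proof (rule summableI_nonneg_bounded)
    fix n
    have "(\<Sum>k<n. (\<Prod>i\<le>k. a i) powr (1 / real (Suc k))) \<le> (\<Sum>i<n. a i * c i / real (i + 1)) - T n / real (n + 1)"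
      unfolding abel[symmetric] by (intro sum_mono term_le)
    also have "\<dots> \<le> (\<Sum>i<n. a i * c i / real (i + 1))" using T_nonneg[of n] by simp
    also have "\<dots> \<le> (\<Sum>i<n. exp 1 * a i)"
    proof (rule sum_mono)
      fix i
      have "a i * c i \<le> a i * (exp 1 * real (i + 1))" by (intro mult_left_mono c_le nonneg)
      then show "a i * c i / real (i + 1) \<le> exp 1 * a i" by (simp add: field_simps)
    qed
    also have "\<dots> \<le> exp 1 * suminf a"
      unfolding sum_distrib_left[symmetric]
      by (intro mult_left_mono sum_le_suminf sm nonneg ballI) auto
    finally show "(\<Sum>k<n. (\<Prod>i\<le>k. a i) powr (1 / real (Suc k))) \<le> exp 1 * suminf a" .
  qed simp
qed

text \<open>A zero spreads to both neighbours by log-convexity; only the first term can resist, because it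
  has no left neighbour.\<close>
lemma log_convex_zero:
  fixes N :: "nat \<Rightarrow> real"
  assumes nonneg: "\<And>k. 0 \<le> N k" and convex: "\<And>k. (N (Suc k))\<^sup>2 \<le> N k * N (Suc (Suc k))"
    and zero: "N k = 0"
  shows "N (Suc j) = 0"
proof -
  have up: "N (Suc i) = 0" if "N i = 0" for i
    using convex[of i] that by simp
  have down: "N (Suc i) = 0" if "N (Suc (Suc i)) = 0" for i
    using convex[of i] that by simp
  have one: "N (Suc 0) = 0"
  proof (cases k)
    case 0 then show ?thesis using up zero by simp
  next
    case (Suc i)
    then show ?thesis using zero
      by (induction i arbitrary: k) (use down in auto)
  qed
  show ?thesis by (induction j) (use one up in auto)
qed

text \<open>The factors \<open>r\<^sub>i\<close> are the quotients \<open>N\<^bsub>i+1\<^esub>/N\<^sub>i\<close>, which log-convexity makes nondecreasing, and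
  \<open>N\<^sub>k\<^bsup>-1/2k\<^esup>\<close> is then up to a bounded factor the geometric mean of the numbers \<open>r\<^sub>i\<^bsup>-1/2\<^esup>\<close>. If some
  \<open>N\<^sub>k\<close> vanishes, then so do all of them from \<open>N\<^sub>1\<close> on, and constant factors serve equally well; so the value \<open>\<infinity>\<close> of a
  term of the series is covered.\<close>
lemma carleman_ratios:
  fixes N :: "nat \<Rightarrow> real"
  assumes nonneg: "\<And>k. 0 \<le> N k" and convex: "\<And>k. (N (Suc k))\<^sup>2 \<le> N k * N (Suc (Suc k))"
    and diverge: "(\<Sum>m. inverse (ennreal (N (Suc m) powr (1 / (2 * real (Suc m)))))) = \<infinity>"
  obtains r C where "0 \<le> C" "\<And>i. 0 < r i" "incseq r" "\<And>j. N j \<le> C * (\<Prod>i<j. r i)"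
    "\<not> summable (\<lambda>i. 1 / sqrt (r i))"
proof (cases "\<exists>k. N k = 0")
  case True
  then have zero: "N (Suc j) = 0" for j using log_convex_zero[of N] nonneg convex by blast
  have "N j \<le> N 0 * (\<Prod>i<j. 1)" for j using zero nonneg[of 0] by (cases j) auto
  moreover have "\<not> summable (\<lambda>i::nat. 1 / sqrt 1 :: real)" by (simp add: summable_const_iff)
  ultimately show ?thesis using that[of "N 0" "\<lambda>_. 1"] nonneg[of 0] by (simp add: incseq_def)
next
  case False
  then have pos: "0 < N k" for k using nonneg[of k] by (metis order_le_less)
  define r where "r i = N (Suc i) / N i" for i
  have r_pos: "0 < r i" for i using pos by (simp add: r_def)
  have r_inc: "incseq r"
  proof (rule incseq_SucI)
    fix i show "r i \<le> r (Suc i)"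
      using convex[of i] pos[of i] pos[of "Suc i"] by (simp add: r_def field_simps power2_eq_square)
  qed
  have N_eq: "N j = N 0 * (\<Prod>i<j. r i)" for j
  proof (induction j)
    case (Suc j)
    have "N (Suc j) = N j * r j" using pos[of j] by (simp add: r_def)
    with Suc show ?case by simp
  qed simp
  have "\<not> summable (\<lambda>i. 1 / sqrt (r i))"
  proof
    assume "summable (\<lambda>i. 1 / sqrt (r i))"
    then have sm: "summable (\<lambda>k. (\<Prod>i\<le>k. 1 / sqrt (r i)) powr (1 / real (Suc k)))"
      by (rule carleman_inequality[rotated]) (use r_pos in \<open>auto intro: less_imp_le\<close>)
    \<comment> \<open>This constant bounds the powers \<open>N\<^sub>0\<^bsup>-1/2k\<^esup>\<close>, which tend to one.\<close>
    define K where "K = max 1 (N 0 powr (-1/2))"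
    define u where "u m = inverse (N (Suc m) powr (1 / (2 * real (Suc m))))" for m
    have u_le: "u m \<le> K * (\<Prod>i\<le>m. 1 / sqrt (r i)) powr (1 / real (Suc m))" for m
    proof -
      let ?P = "\<Prod>i\<le>m. r i" and ?q = "1 / real (Suc m)"
      have P: "0 < ?P" by (intro prod_pos) (use r_pos in auto)
      have prod: "(\<Prod>i\<le>m. 1 / sqrt (r i)) = ?P powr (-1/2)"
      proof -
        have "(\<Prod>i\<le>m. 1 / sqrt (r i)) = 1 / (\<Prod>i\<le>m. sqrt (r i))" by (simp add: prod_dividef)
        also have "(\<Prod>i\<le>m. sqrt (r i)) = sqrt ?P"
          by (induction m) (simp_all add: real_sqrt_mult)
        also have "1 / sqrt ?P = ?P powr (-1/2)" using P
          by (simp add: powr_half_sqrt powr_minus_divide)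
        finally show ?thesis .
      qed
      have "u m = (N 0 * ?P) powr (-1/2 * ?q)"
        unfolding u_def N_eq[of "Suc m"] lessThan_Suc_atMost
        by (simp add: powr_minus[symmetric])
      also have "\<dots> = (N 0 powr (-1/2)) powr ?q * (?P powr (-1/2)) powr ?q"
        using pos[of 0] P by (simp add: powr_mult powr_powr)
      also have "(N 0 powr (-1/2)) powr ?q \<le> K"
      proof (cases "N 0 powr (-1/2) \<le> 1")
        case True
        then have "(N 0 powr (-1/2)) powr ?q \<le> 1" by (intro powr_le1) auto
        then show ?thesis by (simp add: K_def)
      next
        case False
        then have "(N 0 powr (-1/2)) powr ?q \<le> (N 0 powr (-1/2)) powr 1" by (intro powr_mono) auto
        then show ?thesis by (simp add: K_def)
      qed
      finally show ?thesis unfolding prod by (simp add: mult_right_mono)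
    qed
    have "summable u"
      by (rule summable_comparison_test'[OF summable_mult[OF sm, of K], of 0])
        (use u_le in \<open>auto simp: u_def\<close>)
    moreover have "0 \<le> u m" for m by (simp add: u_def)
    ultimately have "(\<Sum>m. ennreal (u m)) = ennreal (suminf u)"
      by (rule suminf_ennreal2[rotated])
    moreover have "ennreal (u m) = inverse (ennreal (N (Suc m) powr (1 / (2 * real (Suc m)))))" for m
      unfolding u_def using pos[of "Suc m"] by (subst inverse_ennreal) (auto simp del: of_nat_Suc)
    ultimately show False using diverge by simp
  qed
  then show ?thesis using that[of "N 0" r] r_pos r_inc N_eq nonneg[of 0] by (metis order_refl)
qed

text \<open>If the perturbed series converged, its terms \<open>u\<^sub>k\<close> would be \<open>O(1/k)\<close>, because they decrease. This
  forces \<open>r\<^sub>k\<close> to grow at least like \<open>k\<^sup>2\<close>, so that the linear perturbation is negligible against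
  \<open>r\<^sub>k\<close> and the unperturbed series would converge as well.\<close>
lemma not_summable_perturb:
  fixes r :: "nat \<Rightarrow> real"
  assumes pos: "\<And>i. 0 < r i" and inc: "incseq r" and c: "0 \<le> c"
    and ns: "\<not> summable (\<lambda>i. 1 / sqrt (r i))"
  shows "\<not> summable (\<lambda>i. 1 / sqrt (r i + c * (2 * real i + 1) + 1))"
proof
  define u where "u = (\<lambda>i. 1 / sqrt (r i + c * (2 * real i + 1) + 1))"
  assume "summable (\<lambda>i. 1 / sqrt (r i + c * (2 * real i + 1) + 1))"
  then have sm: "summable u" unfolding u_def .
  have rho_pos: "0 < r i + c * (2 * real i + 1) + 1" for i
    using pos[of i] c by (smt (verit) mult_nonneg_nonneg of_nat_0_le_iff)
  have u_pos: "0 < u i" for i using rho_pos[of i] by (simp add: u_def)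
  have u_dec: "u j \<le> u i" if "i \<le> j" for i j
    unfolding u_def using that rho_pos incseqD[OF inc that] c
    by (intro divide_left_mono real_sqrt_le_mono mult_pos_pos real_sqrt_gt_zero add_mono mult_left_mono) auto
  define T where "T = suminf u + 1"
  have "0 \<le> suminf u" using u_pos by (intro suminf_nonneg sm) (auto intro: less_imp_le)
  then have T_pos: "0 < T" by (simp add: T_def)
  have ku: "real k * u k \<le> T" for k
  proof -
    have "real k * u k = (\<Sum>i<k. u k)" by simp
    also have "\<dots> \<le> (\<Sum>i<k. u i)" by (intro sum_mono u_dec) auto
    also have "\<dots> \<le> suminf u" using u_pos by (intro sum_le_suminf sm) (auto intro: less_imp_le)
    finally show ?thesis by (simp add: T_def)
  qed
  obtain k1 :: nat where k1: "real k1 \<ge> 2 * T\<^sup>2 * (4 * c + 1)"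
    using real_arch_simple by blast
  \<comment> \<open>From this index on, \<open>k\<^sup>2/T\<^sup>2\<close> exceeds twice the perturbation.\<close>
  define k0 where "k0 = Suc k1"
  have k0: "real k0 \<ge> 2 * T\<^sup>2 * (4 * c + 1)" and "k0 \<ge> 1" using k1 by (auto simp: k0_def)
  have "1 / sqrt (r k) \<le> sqrt 2 * u k" if "k \<ge> k0" for k
  proof -
    let ?R = "r k + c * (2 * real k + 1) + 1"
    have k1: "1 \<le> real k" using that \<open>k0 \<ge> 1\<close> by simp
    have "real k \<le> T * sqrt ?R" using ku[of k] rho_pos[of k] by (simp add: u_def divide_le_eq)
    then have "(real k)\<^sup>2 \<le> (T * sqrt ?R)\<^sup>2" by (intro power_mono) auto
    then have *: "(real k)\<^sup>2 \<le> T\<^sup>2 * ?R" using rho_pos[of k] by (simp add: power_mult_distrib)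
    have "2 * T\<^sup>2 * (4 * c + 1) \<le> real k" using k0 that by linarith
    then have "2 * T\<^sup>2 * (4 * c + 1) * real k \<le> (real k)\<^sup>2" 
      unfolding power2_eq_square[of "real k"] by (intro mult_right_mono) auto
    moreover have "T\<^sup>2 * (2 * (4 * c + 1) * real k) = 2 * T\<^sup>2 * (4 * c + 1) * real k" by simp
    ultimately have "T\<^sup>2 * (2 * (4 * c + 1) * real k) \<le> T\<^sup>2 * ?R" using * by linarith
    then have "2 * (4 * c + 1) * real k \<le> ?R" using T_pos by simp
    moreover have "c \<le> c * real k" using mult_left_mono[OF k1 c] by simp
    moreover have "c * (2 * real k + 1) = 2 * (c * real k) + c" "2 * (4 * c + 1) * real k = 8 * (c * real k) + 2 * real k"
      by (simp_all add: algebra_simps)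
    ultimately have "?R \<le> 2 * r k" using k1 c by linarith
    then have "sqrt ?R \<le> sqrt 2 * sqrt (r k)" by (metis real_sqrt_le_mono real_sqrt_mult)
    then show ?thesis using pos[of k] rho_pos[of k] by (simp add: u_def field_simps)
  qed
  then have "summable (\<lambda>i. 1 / sqrt (r i))"
    by (intro summable_comparison_test'[OF summable_mult[OF sm, of "sqrt 2"], of k0]) (use pos in \<open>simp add: less_imp_le\<close>)
  then show False using ns by simp
qed

text \<open>Read \<open>S m j\<close> as the order \<open>m\<close> Sobolev seminorm of \<open>L\<^sup>j f\<close>. For constant \<open>r\<close> the recursion \<open>two\<close>
  is solved by the products \<open>B k j\<close> below with equality; that they still dominate for nondecreasing \<open>r\<close>
  is the rearrangement inequality \<open>shift\<close>, which says that replacing \<open>r\<^bsub>i+1\<^esub> + d\<^sub>i\<close> by \<open>r\<^sub>i + d\<^sub>i\<close> loses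
  at most the factor \<open>r\<^bsub>i+1\<^esub>/r\<^sub>i\<close>. Odd orders are interpolated between even ones by \<open>one\<close>. The bound is
  expressed with square roots, each used twice, so that it is a product of \<open>m + 1\<close> factors.\<close>
lemma geometric_mean_array_bound:
  fixes S :: "nat \<Rightarrow> nat \<Rightarrow> real"
  assumes r_pos: "\<And>i. 0 < r i" and inc: "incseq r" and c: "0 \<le> c" and C: "0 \<le> C"
    and nonneg: "\<And>m j. 0 \<le> S m j"
    and S0: "\<And>j. S 0 j \<le> C * (\<Prod>i<j. r i)"
    and two: "\<And>m j. S (Suc (Suc m)) j \<le> S m (Suc j) + c * real (Suc m) * S m j"
    and one: "\<And>m j. (S (Suc m) j)\<^sup>2 \<le> S m j * (S m (Suc j) + c * real (Suc m) * S m j)"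
  shows "S m 0 \<le> C * (\<Prod>i<Suc m. sqrt (r (i div 2) + c * (2 * real (i div 2) + 1) + 1))"
proof -
  define d where "d i = c * (2 * real i + 1)" for i
  have d_nonneg: "0 \<le> d i" for i using c by (simp add: d_def)
  have r_le: "r i \<le> r (Suc i)" for i using inc by (simp add: incseq_Suc_iff)
  have shift: "r j * (\<Prod>i<k. r (Suc j + i) + d i) \<le> r (j + k) * (\<Prod>i<k. r (j + i) + d i)" for j k
  proof (induction k)
    case (Suc k)
    have "r j * (\<Prod>i<Suc k. r (Suc j + i) + d i) 
        = (r j * (\<Prod>i<k. r (Suc j + i) + d i)) * (r (Suc j + k) + d k)" by simp
    also have "\<dots> \<le> (r (j + k) * (\<Prod>i<k. r (j + i) + d i)) * (r (Suc j + k) + d k)"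
      using d_nonneg[of k] r_pos[of "Suc j + k"] by (intro mult_right_mono Suc) auto
    also have "\<dots> = (\<Prod>i<k. r (j + i) + d i) * (r (j + k) * (r (Suc j + k) + d k))" by simp
    also have "\<dots> \<le> (\<Prod>i<k. r (j + i) + d i) * (r (Suc j + k) * (r (j + k) + d k))"
    proof (rule mult_left_mono)
      show "r (j + k) * (r (Suc j + k) + d k) \<le> r (Suc j + k) * (r (j + k) + d k)"
        using mult_right_mono[OF r_le[of "j + k"] d_nonneg[of k]] by (simp add: algebra_simps)
      show "0 \<le> (\<Prod>i<k. r (j + i) + d i)"
        using d_nonneg r_pos by (intro prod_nonneg) (auto intro: add_nonneg_nonneg less_imp_le)
    qed
    finally show ?case by (simp add: mult_ac)
  qed simp
  define B where "B k j = C * (\<Prod>i<j. r i) * (\<Prod>i<k. r (j + i) + d i)" for k j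
  have B_step: "B k (Suc j) + d k * B k j \<le> B (Suc k) j" for k j
  proof -
    have "B k (Suc j) = C * (\<Prod>i<j. r i) * (r j * (\<Prod>i<k. r (Suc j + i) + d i))"
      by (simp add: B_def)
    also have "\<dots> \<le> C * (\<Prod>i<j. r i) * (r (j + k) * (\<Prod>i<k. r (j + i) + d i))"
      using C r_pos by (intro mult_left_mono shift mult_nonneg_nonneg prod_nonneg) (auto intro: less_imp_le)
    finally show ?thesis by (simp add: B_def algebra_simps)
  qed
  have even_step: "S (2 * k) (Suc j) + c * real (Suc (2 * k)) * S (2 * k) j \<le> B (Suc k) j"
    if "\<And>j. S (2 * k) j \<le> B k j" for k j
  proof -
    have "S (2 * k) (Suc j) + c * real (Suc (2 * k)) * S (2 * k) j \<le> B k (Suc j) + d k * B k j"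
      using that[of "Suc j"] mult_left_mono[OF that[of j] d_nonneg[of k]] by (simp add: d_def add_ac)
    then show ?thesis using B_step[of k j] by linarith
  qed
  have even: "S (2 * k) j \<le> B k j" for k j
  proof (induction k arbitrary: j)
    case 0 then show ?case using S0 by (simp add: B_def)
  next
    case (Suc k)
    then show ?case using two[of "2 * k" j] even_step[of k j] by simp
  qed
  define rho where "rho i = r i + d i + 1" for i
  have rho_ge: "1 \<le> rho i" for i using r_pos[of i] d_nonneg[of i] by (simp add: rho_def)
  define a where "a i = sqrt (rho (i div 2))" for i
  have a_ge: "1 \<le> a i" for i using rho_ge by (simp add: a_def)
  have prod_a: "(\<Prod>i<2 * k. a i) = (\<Prod>i<k. rho i)" for k
  proof (induction k)
    case (Suc k)
    have "rho k \<ge> 0" using rho_ge[of k] by linarith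
    with Suc show ?case by (simp add: a_def mult.assoc)
  qed simp
  have B_le: "B k 0 \<le> C * (\<Prod>i<2 * k. a i)" for k
    unfolding prod_a B_def using C d_nonneg r_pos
    by (auto intro!: mult_left_mono prod_mono simp: rho_def intro: add_nonneg_nonneg less_imp_le)
  have B_mono: "B k 0 \<le> C * (\<Prod>i<2 * Suc k. a i)" for k
  proof -
    have "C * (\<Prod>i<2 * k. a i) \<le> C * (\<Prod>i<2 * Suc k. a i)"
      using C a_ge by (intro mult_left_mono prod_mono2) (auto intro: order_trans[OF zero_le_one])
    then show ?thesis using B_le[of k] by linarith
  qed
  have "S m 0 \<le> C * (\<Prod>i<Suc m. a i)"
  proof (cases "even m")
    case True
    then obtain k where m: "m = 2 * k" by blast
    have "S m 0 \<le> C * (\<Prod>i<2 * k. a i)" using even[of k 0] B_le[of k] m by simp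
    also have "\<dots> \<le> C * (\<Prod>i<Suc m. a i)" unfolding m
      using C a_ge by (intro mult_left_mono prod_mono2) (auto intro: order_trans[OF zero_le_one])
    finally show ?thesis .
  next
    case False
    then obtain k where m: "m = Suc (2 * k)" by (metis oddE Suc_eq_plus1)
    let ?X = "C * (\<Prod>i<2 * Suc k. a i)"
    have "(S m 0)\<^sup>2 \<le> S (2 * k) 0 * (S (2 * k) (Suc 0) + c * real (Suc (2 * k)) * S (2 * k) 0)"
      using one[of "2 * k" 0] m by simp
    also have "\<dots> \<le> ?X * ?X"
    proof (rule mult_mono)
      show "S (2 * k) 0 \<le> ?X" using even[of k 0] B_mono[of k] by linarith
      show "S (2 * k) (Suc 0) + c * real (Suc (2 * k)) * S (2 * k) 0 \<le> ?X"
        using even_step[of k 0, OF even] B_le[of "Suc k"] by linarith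
      show "0 \<le> ?X" using C a_ge by (intro mult_nonneg_nonneg prod_nonneg) (auto intro: order_trans[OF zero_le_one])
      show "0 \<le> S (2 * k) (Suc 0) + c * real (Suc (2 * k)) * S (2 * k) 0"
        using nonneg c by (intro add_nonneg_nonneg mult_nonneg_nonneg) auto
    qed
    finally have "(S m 0)\<^sup>2 \<le> ?X\<^sup>2" by (simp add: power2_eq_square)
    moreover have "0 \<le> ?X" using C a_ge by (intro mult_nonneg_nonneg prod_nonneg) (auto intro: order_trans[OF zero_le_one])
    ultimately have "S m 0 \<le> ?X" by (rule power2_le_imp_le)
    then show ?thesis unfolding m by simp
  qed
  then show ?thesis unfolding a_def rho_def d_def .
qed

section \<open>Quasi-analyticity on the real line\<close>

text \<open>Bang's proof of the Denjoy-Carleman theorem. Say that the level at \<open>x\<close> is \<open>n\<close> if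
  \<open>|F\<^sub>j(x)| \<le> M\<^sub>j exp(j - n)\<close> for all \<open>j \<le> n\<close>, with \<open>M\<^sub>j = C a\<^sub>0 \<cdots> a\<^bsub>j-1\<^esub>\<close>; flatness at \<open>0\<close> means every level.
  Moving the point by \<open>1/(e a\<^sub>n)\<close> costs at most one level. Starting from a very high level at \<open>0\<close> and
  descending to level \<open>n\<close>, one covers a distance that is a long stretch of a divergent series, so each
  point has every level.\<close>
lemma bang_uniqueness_right:
  fixes F :: "nat \<Rightarrow> real \<Rightarrow> 'a::real_normed_vector"
  assumes deriv: "\<And>j t. (F j has_vector_derivative F (Suc j) t) (at t)"
    and bound: "\<And>j t. norm (F j t) \<le> C * (\<Prod>i<j. a i)"
    and a_pos: "\<And>i. 0 < a i" and inc: "incseq a" and ns: "\<not> summable (\<lambda>i. 1 / a i)"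
    and flat: "\<And>j. F j 0 = 0" and t: "0 \<le> t"
  shows "F 0 t = 0"
proof -
  define M where "M j = C * (\<Prod>i<j. a i)" for j
  have C: "0 \<le> C" using order_trans[OF norm_ge_zero bound[of 0 0]] by simp
  have M_nonneg: "0 \<le> M j" for j
    unfolding M_def using C a_pos by (intro mult_nonneg_nonneg prod_nonneg) (auto intro: less_imp_le)
  define P where "P n x \<longleftrightarrow> (\<forall>j\<le>n. norm (F j x) \<le> M j * exp (real j - real n))" for n x
  \<comment> \<open>Downward induction on \<open>j\<close>: the right-hand side has a derivative that dominates the
    bound for \<open>F\<^bsub>j+1\<^esub>\<close>, because \<open>M\<^bsub>j+1\<^esub> = M\<^sub>j a\<^sub>j\<close> and \<open>a\<^sub>j \<le> a\<^sub>n\<close>.\<close>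
  have grow: "norm (F j (x + h)) \<le> M j * exp (real j - real n) * exp (exp 1 * a n * h)"
    if P: "P n x" and "j \<le> n" "0 \<le> h" for n j x h
    using \<open>j \<le> n\<close> \<open>0 \<le> h\<close>
  proof (induction j arbitrary: h rule: inc_induct)
    case base
    have "norm (F n (x + h)) \<le> M n * 1" using bound[of n "x + h"] by (simp add: M_def)
    also have "\<dots> \<le> M n * exp (exp 1 * a n * h)"
      using M_nonneg[of n] a_pos[of n] base by (intro mult_left_mono) auto
    finally show ?case by simp
  next
    case (step j)
    let ?E = "\<lambda>s. M j * exp (real j - real n) * exp (exp 1 * a n * s)"
    show ?case
    proof (cases "h = 0")
      case True
      then show ?thesis using P step by (simp add: P_def)
    next
      case False
      then have h: "0 < h" using step by simp
      have "norm (F j (x + h) - F j (x + 0)) \<le> ?E h - ?E 0"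
      proof (rule differentiable_bound_general[OF h])
        show "continuous_on {0..h} (\<lambda>s. F j (x + s))"
        proof (rule continuous_on_vector_derivative)
          fix s
          have "((\<lambda>s. F j (x + s)) has_vector_derivative 1 *\<^sub>R F (Suc j) (x + s)) (at s)"
            by (rule vector_diff_chain_at[of "\<lambda>s. x + s" 1 s "F j", unfolded o_def])
              (auto intro!: derivative_eq_intros deriv)
          then show "((\<lambda>s. F j (x + s)) has_vector_derivative F (Suc j) (x + s)) (at s within {0..h})"
            by (simp add: has_vector_derivative_at_within)
        qed
        show "continuous_on {0..h} ?E" by (intro continuous_intros)
      next
        fix s assume s: "0 < s" "s < h"
        have "((\<lambda>s. F j (x + s)) has_vector_derivative 1 *\<^sub>R F (Suc j) (x + s)) (at s)"
          by (rule vector_diff_chain_at[of "\<lambda>s. x + s" 1 s "F j", unfolded o_def])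
            (auto intro!: derivative_eq_intros deriv)
        then show "((\<lambda>s. F j (x + s)) has_vector_derivative F (Suc j) (x + s)) (at s)" by simp
        show "(?E has_vector_derivative (?E s * (exp 1 * a n))) (at s)"
          unfolding has_real_derivative_iff_has_vector_derivative[symmetric]
          by (auto intro!: derivative_eq_intros)
        have "norm (F (Suc j) (x + s)) \<le> M (Suc j) * exp (real (Suc j) - real n) * exp (exp 1 * a n * s)"
          using step.IH[of s] s by simp
        also have "M (Suc j) = M j * a j" by (simp add: M_def)
        also have "exp (real (Suc j) - real n) = exp 1 * exp (real j - real n)"
          by (simp add: exp_add[symmetric])
        also have "M j * a j * (exp 1 * exp (real j - real n)) * exp (exp 1 * a n * s)
            = a j * (?E s * exp 1)" by (simp add: mult_ac)
        also have "\<dots> \<le> a n * (?E s * exp 1)"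
          using incseqD[OF inc, of j n] step M_nonneg[of j] by (intro mult_right_mono) auto
        finally show "norm (F (Suc j) (x + s)) \<le> ?E s * (exp 1 * a n)" by (simp add: mult_ac)
      qed
      moreover have "norm (F j x) \<le> M j * exp (real j - real n)" using P step by (simp add: P_def)
      ultimately show ?thesis using norm_triangle_sub[of "F j (x + h)" "F j x"] by simp
    qed
  qed
  have advance: "P n (x + h)" if P: "P (Suc n) x" and h: "0 \<le> h" "h \<le> 1 / (exp 1 * a (Suc n))" for n x h
    unfolding P_def
  proof (intro allI impI)
    fix j assume "j \<le> n"
    then have "norm (F j (x + h)) \<le> M j * exp (real j - real (Suc n)) * exp (exp 1 * a (Suc n) * h)"
      using grow[OF P _ h(1)] by simp
    also have "\<dots> \<le> M j * exp (real j - real (Suc n)) * exp 1"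
      using h a_pos[of "Suc n"] M_nonneg[of j] by (intro mult_left_mono) (auto simp: field_simps)
    also have "\<dots> = M j * exp (real j - real n)" by (simp add: exp_add[symmetric] mult.assoc)
    finally show "norm (F j (x + h)) \<le> M j * exp (real j - real n)" .
  qed
  define e where "e i = 1 / (exp 1 * a i)" for i
  have e_pos: "0 < e i" for i using a_pos by (simp add: e_def)
  have reach: "P n x" if "0 \<le> x" "x \<le> (\<Sum>i<k. e (Suc (n + i)))" for k n x
    using that
  proof (induction k arbitrary: n x)
    case 0
    then show ?case using flat M_nonneg by (simp add: P_def)
  next
    case (Suc k)
    let ?s = "\<Sum>i<k. e (Suc (Suc n + i))"
    define y where "y = min x ?s"
    have s: "0 \<le> ?s" using e_pos by (intro sum_nonneg) (auto intro: less_imp_le)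
    have split: "(\<Sum>i<Suc k. e (Suc (n + i))) = e (Suc n) + ?s"
      by (subst sum.lessThan_Suc_shift) simp
    have "P (Suc n) y" using Suc.IH[of y "Suc n"] Suc.prems s by (auto simp: y_def)
    then have "P n (y + (x - y))"
      by (rule advance) (use Suc.prems split e_pos[of "Suc n"] in \<open>auto simp: y_def e_def min_def\<close>)
    then show ?case by simp
  qed
  have P_all: "P n t" for n
  proof -
    have "\<not> summable (\<lambda>i. e (Suc (n + i)))"
    proof
      assume "summable (\<lambda>i. e (Suc (n + i)))"
      then have "summable (\<lambda>i. e (i + Suc n))" by (simp add: add_ac)
      then have "summable e" by (subst (asm) summable_iff_shift)
      then have "summable (\<lambda>i. exp 1 * e i)" by (rule summable_mult)
      then show False using ns by (simp add: e_def)
    qed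
    then have "\<not> (\<forall>k. (\<Sum>i<k. e (Suc (n + i))) \<le> t)"
      using summableI_nonneg_bounded[of "\<lambda>i. e (Suc (n + i))" t] e_pos by (meson less_imp_le)
    then obtain k where "t \<le> (\<Sum>i<k. e (Suc (n + i)))" by (auto simp: not_le intro: less_imp_le)
    then show ?thesis using reach[OF t] by blast
  qed
  have le: "norm (F 0 t) \<le> C * exp (- real n)" for n
    using P_all[of n] by (auto simp: P_def M_def)
  have "(\<lambda>n. C * exp (- real n)) \<longlonglongrightarrow> C * 0"
    by (intro tendsto_mult_left filterlim_compose[OF exp_at_bot] filterlim_compose[OF filterlim_uminus_at_bot_at_top] filterlim_real_sequentially)
  then have "norm (F 0 t) \<le> C * 0"
    by (rule LIMSEQ_le_const) (use le in auto)
  then show ?thesis by simp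
qed

text \<open>Negative times are handled by reflection, which changes \<open>F\<^sub>j\<close> by the sign \<open>(-1)\<^sup>j\<close>.\<close>
lemma bang_uniqueness:
  fixes F :: "nat \<Rightarrow> real \<Rightarrow> 'a::real_normed_vector"
  assumes deriv: "\<And>j t. (F j has_vector_derivative F (Suc j) t) (at t)"
    and bound: "\<And>j t. norm (F j t) \<le> C * (\<Prod>i<j. a i)"
    and a_pos: "\<And>i. 0 < a i" and inc: "incseq a" and ns: "\<not> summable (\<lambda>i. 1 / a i)"
    and flat: "\<And>j. F j 0 = 0"
  shows "F 0 t = 0"
proof (cases "0 \<le> t")
  case True
  then show ?thesis using bang_uniqueness_right[OF assms] by blast
next
  case False
  let ?G = "\<lambda>j t. (-1) ^ j *\<^sub>R F j (- t)"
  have "?G 0 (- t) = 0"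
  proof (rule bang_uniqueness_right[of ?G C a])
    fix j t
    have "((\<lambda>t. F j (- t)) has_vector_derivative (-1) *\<^sub>R F (Suc j) (- t)) (at t)"
      by (rule vector_diff_chain_at[of uminus "-1" t "F j", unfolded o_def])
        (auto intro!: derivative_eq_intros deriv)
    then have "((\<lambda>t. (-1) ^ j *\<^sub>R F j (- t)) has_vector_derivative (-1) ^ j *\<^sub>R ((-1) *\<^sub>R F (Suc j) (- t))) (at t)"
      by (intro bounded_linear.has_vector_derivative[OF bounded_linear_scaleR_right])
    then show "(?G j has_vector_derivative ?G (Suc j) t) (at t)" by simp
    show "norm (?G j t) \<le> C * (\<Prod>i<j. a i)" using bound[of j "- t"] by simp
  qed (use assms False in auto)
  then show ?thesis by simp
qed

section \<open>Calculus of smooth functions\<close>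

lemma partial_deriv_eqI:
  assumes "((\<lambda>t. f (z + t *\<^sub>R v)) has_vector_derivative d) (at 0)"
  shows "partial_deriv v f z = d"
  unfolding partial_deriv_def by (rule vector_derivative_at[OF assms])

text \<open>Smoothness as a greatest fixed point. The closure properties below follow by exhibiting a set of
  functions that is stable under partial derivatives, which avoids any Leibniz formula for iterated
  derivatives.\<close>
lemma smooth_coinduct:
  assumes "f \<in> S"
    and "\<And>g. g \<in> S \<Longrightarrow> continuous_on UNIV g"
    and "\<And>g v z. g \<in> S \<Longrightarrow> v \<in> Basis \<Longrightarrow> (\<lambda>t. g (z + t *\<^sub>R v)) differentiable (at 0)"
    and "\<And>g v. g \<in> S \<Longrightarrow> v \<in> Basis \<Longrightarrow> partial_deriv v g \<in> S"
  shows "smooth f"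
proof -
  have "iterated_partial vs f \<in> S" if "set vs \<subseteq> Basis" for vs
    using that by (induction vs) (use assms in \<open>auto simp: iterated_partial_def\<close>)
  then show ?thesis using assms(2,3) unfolding smooth_def by blast
qed

lemma smooth_partial:
  assumes "smooth f" "v \<in> Basis"
  shows "smooth (partial_deriv v f)"
proof -
  have "iterated_partial vs (partial_deriv v f) = iterated_partial (vs @ [v]) f" for vs
    by (simp add: iterated_partial_def)
  then show ?thesis using assms unfolding smooth_def by simp
qed

lemma smooth_imp_continuous: "smooth f \<Longrightarrow> continuous_on UNIV f"
  unfolding smooth_def by (drule spec[of _ "[]"]) (simp add: iterated_partial_def)

lemma smooth_imp_differentiable:
  "smooth f \<Longrightarrow> v \<in> Basis \<Longrightarrow> (\<lambda>t. f (z + t *\<^sub>R v)) differentiable (at 0)"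
  unfolding smooth_def by (drule spec[of _ "[]"]) (simp add: iterated_partial_def)

lemma smooth_has_partial:
  assumes "smooth f" "v \<in> Basis"
  shows "((\<lambda>t. f (z + t *\<^sub>R v)) has_vector_derivative partial_deriv v f (z + s *\<^sub>R v)) (at s)"
proof -
  have "((\<lambda>t. f (z + s *\<^sub>R v + t *\<^sub>R v)) has_vector_derivative partial_deriv v f (z + s *\<^sub>R v)) (at 0)"
    using smooth_imp_differentiable[OF assms] unfolding partial_deriv_def by (simp add: vector_derivative_works)
  then have "((\<lambda>t. f (z + s *\<^sub>R v + t *\<^sub>R v)) has_vector_derivative partial_deriv v f (z + s *\<^sub>R v)) (at (s - s))"
    by simp
  then have "(((\<lambda>t. f (z + s *\<^sub>R v + t *\<^sub>R v)) \<circ> (\<lambda>t. t - s)) has_vector_derivative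
      1 *\<^sub>R partial_deriv v f (z + s *\<^sub>R v)) (at s)"
    by (intro vector_diff_chain_at) (auto intro!: derivative_eq_intros)
  then show ?thesis by (simp add: o_def algebra_simps)
qed

lemma smooth_has_partial_0:
  assumes "smooth f" "v \<in> Basis"
  shows "((\<lambda>t. f (z + t *\<^sub>R v)) has_vector_derivative partial_deriv v f z) (at 0)"
  using smooth_has_partial[OF assms, of z 0] by simp

lemma partial_deriv_add:
  assumes "smooth f" "smooth g" "v \<in> Basis"
  shows "partial_deriv v (\<lambda>z. f z + g z) = (\<lambda>z. partial_deriv v f z + partial_deriv v g z)"
  by (intro ext partial_deriv_eqI has_vector_derivative_add smooth_has_partial_0 assms)

lemma smooth_add:
  fixes f g :: "'a::euclidean_space \<Rightarrow> 'b::real_normed_vector"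
  assumes "smooth f" "smooth g"
  shows "smooth (\<lambda>z. f z + g z)"
proof (rule smooth_coinduct[of _ "{h. \<exists>f g. smooth f \<and> smooth g \<and> h = (\<lambda>z. f z + g z)}"])
  fix h :: "'a \<Rightarrow> 'b" and v :: 'a assume h: "h \<in> {h. \<exists>f g. smooth f \<and> smooth g \<and> h = (\<lambda>z. f z + g z)}" and v: "v \<in> Basis"
  then obtain f g where fg: "smooth f" "smooth g" "h = (\<lambda>z. f z + g z)" by blast
  show "partial_deriv v h \<in> {h. \<exists>f g. smooth f \<and> smooth g \<and> h = (\<lambda>z. f z + g z)}"
    using smooth_partial fg v partial_deriv_add by blast
  show "(\<lambda>t. h (z + t *\<^sub>R v)) differentiable at 0" for z
    unfolding fg(3) by (intro differentiable_add smooth_imp_differentiable fg v)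
next
  fix h :: "'a \<Rightarrow> 'b" assume "h \<in> {h. \<exists>f g. smooth f \<and> smooth g \<and> h = (\<lambda>z. f z + g z)}"
  then show "continuous_on UNIV h" by (auto intro!: continuous_on_add dest!: smooth_imp_continuous)
qed (use assms in auto)

lemma partial_deriv_zero: "partial_deriv v (\<lambda>_. 0) = (\<lambda>_. 0)"
  by (intro ext partial_deriv_eqI) (auto intro!: derivative_eq_intros)

lemma smooth_zero: "smooth (\<lambda>_. 0)"
  by (rule smooth_coinduct[of _ "{\<lambda>_. 0}"]) (auto simp: partial_deriv_zero)

lemma partial_deriv_cmult:
  fixes f :: "'a::euclidean_space \<Rightarrow> complex"
  assumes "smooth f" "v \<in> Basis"
  shows "partial_deriv v (\<lambda>z. c * f z) = (\<lambda>z. c * partial_deriv v f z)"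
  by (intro ext partial_deriv_eqI has_vector_derivative_mult_right smooth_has_partial_0 assms)

lemma smooth_cmult:
  fixes f :: "'a::euclidean_space \<Rightarrow> complex"
  assumes "smooth f"
  shows "smooth (\<lambda>z. c * f z)"
proof (rule smooth_coinduct[of _ "{h. \<exists>f. smooth f \<and> h = (\<lambda>z. c * f z)}"])
  fix h :: "'a \<Rightarrow> complex" and v :: 'a assume h: "h \<in> {h. \<exists>f. smooth f \<and> h = (\<lambda>z. c * f z)}" and v: "v \<in> Basis"
  then obtain f where f: "smooth f" "h = (\<lambda>z. c * f z)" by blast
  show "partial_deriv v h \<in> {h. \<exists>f. smooth f \<and> h = (\<lambda>z. c * f z)}"
    using smooth_partial f v partial_deriv_cmult by blast
  show "(\<lambda>t. h (z + t *\<^sub>R v)) differentiable at 0" for z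
    unfolding f(2) by (intro differentiable_mult differentiable_const smooth_imp_differentiable f v)
next
  fix h :: "'a \<Rightarrow> complex" assume "h \<in> {h. \<exists>f. smooth f \<and> h = (\<lambda>z. c * f z)}"
  then show "continuous_on UNIV h" by (auto intro!: continuous_on_mult_left dest!: smooth_imp_continuous)
qed (use assms in auto)

lemma smooth_sum:
  "(\<And>i. i \<in> I \<Longrightarrow> smooth (f i)) \<Longrightarrow> smooth (\<lambda>z. \<Sum>i\<in>I. f i z)"
  by (induction I rule: infinite_finite_induct) (auto intro: smooth_add smooth_zero)

lemma inner_line_has_derivative:
  "((\<lambda>t. complex_of_real ((z + t *\<^sub>R v) \<bullet> k)) has_vector_derivative of_real (v \<bullet> k)) (at s)"
  unfolding inner_add_left inner_scaleR_left
  by (auto intro!: derivative_eq_intros)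

lemma partial_deriv_linear_mult:
  fixes f :: "'a::euclidean_space \<Rightarrow> complex"
  assumes "smooth f" "v \<in> Basis"
  shows "partial_deriv v (\<lambda>z. of_real (z \<bullet> k) * f z)
    = (\<lambda>z. of_real (z \<bullet> k) * partial_deriv v f z + of_real (v \<bullet> k) * f z)"
proof (intro ext partial_deriv_eqI)
  fix z
  from has_vector_derivative_mult[OF inner_line_has_derivative smooth_has_partial_0[OF assms, of z]]
  show "((\<lambda>t. of_real ((z + t *\<^sub>R v) \<bullet> k) * f (z + t *\<^sub>R v)) has_vector_derivative
      of_real (z \<bullet> k) * partial_deriv v f z + of_real (v \<bullet> k) * f z) (at 0)" by simp
qed

lemma smooth_linear_mult:
  fixes f :: "'a::euclidean_space \<Rightarrow> complex"
  assumes "smooth f"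
  shows "smooth (\<lambda>z. of_real (z \<bullet> k) * f z)"
proof -
  \<comment> \<open>Products with a linear function alone are not stable under differentiation; adding a smooth
    remainder makes them so.\<close>
  let ?S = "{h :: 'a \<Rightarrow> complex. \<exists>f g. smooth f \<and> smooth g \<and> h = (\<lambda>z. of_real (z \<bullet> k) * f z + g z)}"
  show ?thesis
  proof (rule smooth_coinduct[of _ ?S])
    show "(\<lambda>z. of_real (z \<bullet> k) * f z) \<in> ?S"
    proof -
      have "(\<lambda>z. of_real (z \<bullet> k) * f z) = (\<lambda>z. of_real (z \<bullet> k) * f z + 0)" by simp
      then show ?thesis using assms smooth_zero by blast
    qed
  next
    fix h assume "h \<in> ?S"
    then obtain f g where fg: "smooth f" "smooth g" "h = (\<lambda>z. of_real (z \<bullet> k) * f z + g z)" by blast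
    show "continuous_on UNIV h" unfolding fg(3)
      using smooth_imp_continuous[OF fg(1)] smooth_imp_continuous[OF fg(2)] by (intro continuous_intros)
    fix v :: 'a assume v: "v \<in> Basis"
    have der: "((\<lambda>t. h (z + t *\<^sub>R v)) has_vector_derivative
        of_real (z \<bullet> k) * partial_deriv v f z + (of_real (v \<bullet> k) * f z + partial_deriv v g z)) (at 0)" for z
    proof -
      from has_vector_derivative_add[OF has_vector_derivative_mult[OF inner_line_has_derivative[of z v k 0]
           smooth_has_partial_0[OF fg(1) v, of z]]
         smooth_has_partial_0[OF fg(2) v, of z]]
      show ?thesis unfolding fg(3) by (simp add: add.assoc)
    qed
    show "(\<lambda>t. h (z + t *\<^sub>R v)) differentiable at 0" for z
      using der by (rule differentiableI_vector)
    have "partial_deriv v h = (\<lambda>z. of_real (z \<bullet> k) * partial_deriv v f z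
        + (of_real (v \<bullet> k) * f z + partial_deriv v g z))"
      by (intro ext partial_deriv_eqI der)
    then show "partial_deriv v h \<in> ?S"
      using smooth_partial[OF fg(1) v] smooth_add[OF smooth_cmult[OF fg(1)] smooth_partial[OF fg(2) v]] by blast
  qed
qed

text \<open>Integrate \<open>\<partial>\<^sub>v f\<close> along \<open>v\<close>, differentiate under the integral sign in direction \<open>u\<close>, and recover
  the integrand as the derivative in the upper limit of integration.\<close>
lemma partial_deriv_commute:
  fixes f :: "'a::euclidean_space \<Rightarrow> 'b::banach"
  assumes f: "smooth f" and u: "u \<in> Basis" and v: "v \<in> Basis"
  shows "partial_deriv u (partial_deriv v f) z = partial_deriv v (partial_deriv u f) z"
proof -
  let ?fu = "partial_deriv u f" and ?fv = "partial_deriv v f"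
  note smooths = smooth_partial[OF f u] smooth_partial[OF f v] smooth_partial[OF smooth_partial[OF f v] u]
  have cont: "continuous_on A (\<lambda>x. g (h x))" if "smooth g" "continuous_on A h" 
    for g :: "'a \<Rightarrow> 'b" and A :: "'c::topological_space set" and h
    using continuous_on_compose2[OF smooth_imp_continuous[OF that(1)] that(2)] by simp
  have eq: "?fu (z + t *\<^sub>R v) - ?fu z = integral {0..t} (\<lambda>\<tau>. partial_deriv u ?fv (z + \<tau> *\<^sub>R v))"
    if t: "0 \<le> t" for t
  proof -
    have ftc: "f (z + t *\<^sub>R v + s *\<^sub>R u) - f (z + s *\<^sub>R u) = integral {0..t} (\<lambda>\<tau>. ?fv (z + \<tau> *\<^sub>R v + s *\<^sub>R u))" for s
    proof -
      have "((\<lambda>\<tau>. ?fv (z + s *\<^sub>R u + \<tau> *\<^sub>R v)) has_integral f (z + s *\<^sub>R u + t *\<^sub>R v) - f (z + s *\<^sub>R u + 0 *\<^sub>R v)) {0..t}"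
        by (rule fundamental_theorem_of_calculus[OF t])
          (rule has_vector_derivative_at_within[OF smooth_has_partial[OF f v]])
      from integral_unique[OF this] show ?thesis by (simp add: algebra_simps)
    qed
    have "((\<lambda>s. integral (cbox 0 t) (\<lambda>\<tau>. ?fv (z + \<tau> *\<^sub>R v + s *\<^sub>R u))) has_vector_derivative
        integral (cbox 0 t) (\<lambda>\<tau>. partial_deriv u ?fv (z + \<tau> *\<^sub>R v + 0 *\<^sub>R u))) (at 0 within UNIV)"
    proof (rule leibniz_rule_vector_derivative)
      fix s \<tau>
      show "((\<lambda>s. ?fv (z + \<tau> *\<^sub>R v + s *\<^sub>R u)) has_vector_derivative partial_deriv u ?fv (z + \<tau> *\<^sub>R v + s *\<^sub>R u)) (at s within UNIV)"
        by (rule smooth_has_partial[OF smooths(2) u])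
      show "(\<lambda>\<tau>. ?fv (z + \<tau> *\<^sub>R v + s *\<^sub>R u)) integrable_on cbox 0 t"
        by (intro integrable_continuous cont smooths continuous_intros)
      show "continuous_on (UNIV \<times> cbox 0 t) (\<lambda>(s, \<tau>). partial_deriv u ?fv (z + \<tau> *\<^sub>R v + s *\<^sub>R u))"
        unfolding case_prod_beta by (intro cont smooths continuous_intros)
    qed auto
    moreover have "((\<lambda>s. f (z + t *\<^sub>R v + s *\<^sub>R u) - f (z + s *\<^sub>R u)) has_vector_derivative ?fu (z + t *\<^sub>R v) - ?fu z) (at 0)"
      by (intro has_vector_derivative_diff smooth_has_partial_0 f u)
    ultimately show ?thesis unfolding ftc using vector_derivative_unique_at by fastforce
  qed
  have "((\<lambda>t. integral {0..t} (\<lambda>\<tau>. partial_deriv u ?fv (z + \<tau> *\<^sub>R v))) has_vector_derivative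
      partial_deriv u ?fv (z + 0 *\<^sub>R v)) (at 0 within {0..1})"
    by (rule integral_has_vector_derivative) (auto intro!: cont smooths continuous_intros)
  then have "((\<lambda>t. ?fu (z + t *\<^sub>R v) - ?fu z) has_vector_derivative partial_deriv u ?fv z) (at 0 within {0..1})"
    by (subst has_vector_derivative_cong_ev[where g = "\<lambda>t. integral {0..t} (\<lambda>\<tau>. partial_deriv u ?fv (z + \<tau> *\<^sub>R v))"])
      (auto simp: eq eventually_at_filter)
  moreover have "((\<lambda>t. ?fu (z + t *\<^sub>R v) - ?fu z) has_vector_derivative partial_deriv v ?fu z - 0) (at 0 within {0..1})"
    by (rule has_vector_derivative_diff[OF has_vector_derivative_at_within[OF smooth_has_partial_0[OF smooths(1) v]]
          has_vector_derivative_const])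
  ultimately show ?thesis
    using vector_derivative_unique_within_closed_interval[of 0 1 0] by fastforce
qed

section \<open>Magnetic derivatives and the magnetic Laplacian\<close>

text \<open>\<open>K b\<close> is the gradient of the component of a linear vector potential in direction \<open>b\<close>.\<close>
definition magnetic_deriv ::
    "('a::euclidean_space \<Rightarrow> 'a) \<Rightarrow> 'a \<Rightarrow> ('a \<Rightarrow> complex) \<Rightarrow> 'a \<Rightarrow> complex" where
  "magnetic_deriv K b g z = partial_deriv b g z + \<i> * (of_real (z \<bullet> K b) * g z)"

definition magnetic_laplacian ::
    "('a::euclidean_space \<Rightarrow> 'a) \<Rightarrow> ('a \<Rightarrow> complex) \<Rightarrow> 'a \<Rightarrow> complex" where
  "magnetic_laplacian K g z = - (\<Sum>b\<in>Basis. magnetic_deriv K b (magnetic_deriv K b g) z)"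

text \<open>The components of the magnetic field, up to sign: \<open>\<i> field_strength K b c\<close> is the commutator of the
  magnetic derivatives in directions \<open>b\<close> and \<open>c\<close>. It is constant since the potential is linear.\<close>
definition field_strength :: "('a::euclidean_space \<Rightarrow> 'a) \<Rightarrow> 'a \<Rightarrow> 'a \<Rightarrow> real" where
  "field_strength K b c = b \<bullet> K c - c \<bullet> K b"

lemma smooth_magnetic_deriv:
  assumes "smooth g" "b \<in> Basis" shows "smooth (magnetic_deriv K b g)"
  unfolding magnetic_deriv_def[abs_def]
  by (intro smooth_add smooth_cmult smooth_linear_mult smooth_partial assms)

lemma smooth_magnetic_laplacian:
  assumes "smooth g" shows "smooth (magnetic_laplacian K g)"
proof -
  have "smooth (\<lambda>z. (-1) * (\<Sum>b\<in>Basis. magnetic_deriv K b (magnetic_deriv K b g) z))"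
    by (intro smooth_cmult smooth_sum smooth_magnetic_deriv assms)
  then show ?thesis by (simp add: magnetic_laplacian_def[abs_def])
qed

lemma magnetic_deriv_add:
  assumes "smooth f" "smooth g" "b \<in> Basis"
  shows "magnetic_deriv K b (\<lambda>z. f z + g z) = (\<lambda>z. magnetic_deriv K b f z + magnetic_deriv K b g z)"
  using partial_deriv_add[OF assms] by (simp add: magnetic_deriv_def fun_eq_iff algebra_simps)

lemma magnetic_deriv_cmult:
  assumes "smooth f" "b \<in> Basis"
  shows "magnetic_deriv K b (\<lambda>z. c * f z) = (\<lambda>z. c * magnetic_deriv K b f z)"
  using partial_deriv_cmult[OF assms] by (simp add: magnetic_deriv_def fun_eq_iff algebra_simps)

lemma magnetic_deriv_zero: "magnetic_deriv K b (\<lambda>_. 0) = (\<lambda>_. 0)"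
  by (simp add: magnetic_deriv_def fun_eq_iff partial_deriv_zero)

lemma magnetic_deriv_sum:
  assumes "\<And>i. i \<in> I \<Longrightarrow> smooth (f i)" "b \<in> Basis"
  shows "magnetic_deriv K b (\<lambda>z. \<Sum>i\<in>I. f i z) = (\<lambda>z. \<Sum>i\<in>I. magnetic_deriv K b (f i) z)"
  using assms(1)
proof (induction I rule: infinite_finite_induct)
  case (insert i I)
  then show ?case by (simp add: magnetic_deriv_add smooth_sum assms(2))
qed (simp_all add: magnetic_deriv_zero)

lemma magnetic_deriv_twice:
  assumes "smooth g" "b \<in> Basis" "c \<in> Basis"
  shows "magnetic_deriv K b (magnetic_deriv K c g) z =
      partial_deriv b (partial_deriv c g) z + \<i> * of_real (z \<bullet> K c) * partial_deriv b g z
      + \<i> * of_real (z \<bullet> K b) * partial_deriv c g z + \<i> * of_real (b \<bullet> K c) * g z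
      - of_real (z \<bullet> K b) * of_real (z \<bullet> K c) * g z"
proof -
  have "partial_deriv b (\<lambda>z. partial_deriv c g z + \<i> * (of_real (z \<bullet> K c) * g z)) z
     = partial_deriv b (partial_deriv c g) z + \<i> * (of_real (z \<bullet> K c) * partial_deriv b g z + of_real (b \<bullet> K c) * g z)"
    using assms
    by (simp add: partial_deriv_add partial_deriv_cmult partial_deriv_linear_mult smooth_cmult
        smooth_linear_mult smooth_partial)
  then show ?thesis
    unfolding magnetic_deriv_def[abs_def] by (simp add: algebra_simps)
qed

lemma magnetic_deriv_commutator:
  assumes "smooth g" "b \<in> Basis" "c \<in> Basis"
  shows "magnetic_deriv K b (magnetic_deriv K c g) =
    (\<lambda>z. magnetic_deriv K c (magnetic_deriv K b g) z + \<i> * of_real (field_strength K b c) * g z)"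
  unfolding fun_eq_iff magnetic_deriv_twice[OF assms] magnetic_deriv_twice[OF assms(1) assms(3) assms(2)]
    partial_deriv_commute[OF assms]
  by (simp add: field_strength_def algebra_simps)

lemma magnetic_laplacian_deriv:
  assumes g: "smooth g" and c: "c \<in> Basis"
  shows "magnetic_laplacian K (magnetic_deriv K c g) =
    (\<lambda>z. magnetic_deriv K c (magnetic_laplacian K g) z
      + (\<Sum>b\<in>Basis. - 2 * \<i> * of_real (field_strength K b c) * magnetic_deriv K b g z))"
proof
  fix z
  let ?D = "magnetic_deriv K"
  have *: "?D b (?D b (?D c g)) z = ?D c (?D b (?D b g)) z + 2 * \<i> * of_real (field_strength K b c) * ?D b g z"
    if b: "b \<in> Basis" for b
  proof -
    note sm = smooth_magnetic_deriv g b c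
    have "?D b (?D b (?D c g)) = ?D b (\<lambda>z. ?D c (?D b g) z + \<i> * of_real (field_strength K b c) * g z)"
      by (subst magnetic_deriv_commutator[OF g b c]) simp
    also have "\<dots> = (\<lambda>z. ?D b (?D c (?D b g)) z + \<i> * of_real (field_strength K b c) * ?D b g z)"
      by (subst magnetic_deriv_add) (auto intro!: sm smooth_cmult simp: magnetic_deriv_cmult[OF g b])
    also have "?D b (?D c (?D b g)) = (\<lambda>z. ?D c (?D b (?D b g)) z + \<i> * of_real (field_strength K b c) * ?D b g z)"
      by (rule magnetic_deriv_commutator) (auto intro!: sm)
    finally show ?thesis by simp
  qed
  have "?D c (magnetic_laplacian K g) = ?D c (\<lambda>z. (-1) * (\<Sum>b\<in>Basis. ?D b (?D b g) z))"
    by (simp add: magnetic_laplacian_def[abs_def])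
  also have "\<dots> = (\<lambda>z. (-1) * (\<Sum>b\<in>Basis. ?D c (?D b (?D b g)) z))"
    by (subst magnetic_deriv_cmult, intro smooth_sum smooth_magnetic_deriv g, simp_all add: c)
      (subst magnetic_deriv_sum, auto intro!: smooth_magnetic_deriv g c)
  finally show "magnetic_laplacian K (?D c g) z = ?D c (magnetic_laplacian K g) z
      + (\<Sum>b\<in>Basis. - 2 * \<i> * of_real (field_strength K b c) * ?D b g z)"
    by (simp add: magnetic_laplacian_def * sum.distrib sum_negf)
qed

text \<open>On a line the magnetic potential can be gauged away: the phase is the integral of
  \<open>(z + s b) \<bullet> K b\<close> over \<open>0 \<le> s \<le> t\<close>. Iterating, \<open>D\<^sub>b\<^sup>m\<close> becomes the \<open>m\<close>-th derivative of a function of one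
  real variable.\<close>
lemma gauge_has_derivative:
  assumes "smooth g" "b \<in> Basis"
  shows "((\<lambda>t. cis (t * (z \<bullet> K b) + t\<^sup>2 / 2 * (b \<bullet> K b)) * g (z + t *\<^sub>R b)) has_vector_derivative
      cis (t * (z \<bullet> K b) + t\<^sup>2 / 2 * (b \<bullet> K b)) * magnetic_deriv K b g (z + t *\<^sub>R b)) (at t)"
proof -
  let ?p = "\<lambda>t. t * (z \<bullet> K b) + t\<^sup>2 / 2 * (b \<bullet> K b)"
  have "((\<lambda>t. cis (?p t)) has_vector_derivative (z \<bullet> K b + t * (b \<bullet> K b)) *\<^sub>R (\<i> * cis (?p t))) (at t)"
  proof (rule vector_diff_chain_at[of ?p _ t cis, unfolded o_def])
    show "(?p has_vector_derivative z \<bullet> K b + t * (b \<bullet> K b)) (at t)"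
      unfolding has_real_derivative_iff_has_vector_derivative[symmetric]
      by (auto intro!: derivative_eq_intros)
    show "(cis has_vector_derivative \<i> * cis (?p t)) (at (?p t))"
      unfolding has_vector_derivative_complex_iff
      by (auto intro!: derivative_eq_intros)
  qed
  from has_vector_derivative_mult[OF this smooth_has_partial[OF assms, of z t]]
  show ?thesis
    by (simp add: magnetic_deriv_def inner_add_left scaleR_conv_of_real algebra_simps)
qed

text \<open>Multiplication by \<open>\<i>\<close>, scaled: with \<open>z\<^sub>j = x\<^sub>j + \<i> y\<^sub>j\<close> the magnetic derivatives are
  \<open>\<partial>/\<partial>x\<^sub>j + \<i>(l/2) y\<^sub>j\<close> and \<open>\<partial>/\<partial>y\<^sub>j - \<i>(l/2) x\<^sub>j\<close>, the Heisenberg fields on functions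
  \<open>f(z) exp(\<i>lt)\<close>.\<close>
definition heisenberg_potential :: "real \<Rightarrow> complex ^ 'n::finite \<Rightarrow> complex ^ 'n" where
  "heisenberg_potential l b = (\<chi> k. of_real (l / 2) * (\<i> * b $ k))"

lemma sum_Basis_complex_vec:
  fixes h :: "complex ^ 'n::finite \<Rightarrow> 'b::comm_monoid_add"
  shows "(\<Sum>b\<in>Basis. h b) = (\<Sum>j\<in>UNIV. h (axis j 1) + h (axis j \<i>))"
proof -
  have "(\<Sum>b\<in>Basis. h b) = (\<Sum>j\<in>UNIV. \<Sum>b\<in>{axis j 1, axis j \<i>}. h b)"
    unfolding Basis_vec_def Basis_complex_def
    by (subst sum.UNION_disjoint[symmetric]) (auto simp: axis_eq_axis insert_commute)
  also have "\<dots> = (\<Sum>j\<in>UNIV. h (axis j 1) + h (axis j \<i>))"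
    by (intro sum.cong refl) (simp add: axis_eq_axis)
  finally show ?thesis .
qed

lemma special_hermite_eq_magnetic:
  fixes f :: "complex ^ 'n::finite \<Rightarrow> complex"
  assumes f: "smooth f"
  shows "special_hermite l f = magnetic_laplacian (heisenberg_potential l) f"
proof
  fix z :: "complex ^ 'n"
  let ?K = "heisenberg_potential l :: complex ^ 'n \<Rightarrow> _"
  have basis: "axis j (1::complex) \<in> Basis" "axis j \<i> \<in> Basis" for j :: 'n
    by (auto simp: Basis_vec_def Basis_complex_def axis_eq_axis)
  have K: "?K (axis j 1) = axis j (of_real (l / 2) * \<i>)" "?K (axis j \<i>) = axis j (- of_real (l / 2))" for j
    by (auto simp: heisenberg_potential_def vec_eq_iff axis_def)
  have norm: "(norm z)\<^sup>2 = (\<Sum>j\<in>UNIV. (Re (z $ j))\<^sup>2 + (Im (z $ j))\<^sup>2)"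
    by (simp add: norm_vec_def L2_set_def sum_nonneg cmod_power2)
  have x: "magnetic_deriv ?K (axis j 1) (magnetic_deriv ?K (axis j 1) f) z =
      partial_x j (partial_x j f) z + \<i> * of_real l * (of_real (Im (z $ j)) * partial_x j f z)
      - of_real (l\<^sup>2 / 4 * (Im (z $ j))\<^sup>2) * f z" for j
    using f basis(1)[of j]
    by (simp add: magnetic_deriv_twice K inner_axis partial_x_def inner_complex_def algebra_simps power2_eq_square)
  have y: "magnetic_deriv ?K (axis j \<i>) (magnetic_deriv ?K (axis j \<i>) f) z =
      partial_y j (partial_y j f) z - \<i> * of_real l * (of_real (Re (z $ j)) * partial_y j f z)
      - of_real (l\<^sup>2 / 4 * (Re (z $ j))\<^sup>2) * f z" for j
    using f basis(2)[of j]
    by (simp add: magnetic_deriv_twice K inner_axis partial_y_def inner_complex_def algebra_simps power2_eq_square)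
  show "special_hermite l f z = magnetic_laplacian ?K f z"
    unfolding special_hermite_def magnetic_laplacian_def sum_Basis_complex_vec x y laplacian_def
      rotation_field_def norm
    by (simp add: sum.distrib sum_subtractf sum_distrib_left sum_distrib_right algebra_simps sum_negf add_divide_distrib sum_divide_distrib)
qed

section \<open>Square integrable functions and integration by parts\<close>

lemma integral_translation:
  fixes f :: "'a::euclidean_space \<Rightarrow> 'b::{banach, second_countable_topology}"
  assumes "f \<in> borel_measurable borel"
  shows "(LINT z|lborel. f (z + c)) = integral\<^sup>L lborel f"
proof -
  have "integral\<^sup>L lborel f = integral\<^sup>L (distr lborel borel ((+) c)) f" by (simp add: lborel_distr_plus)
  also have "\<dots> = (LINT z|lborel. f (c + z))" by (rule integral_distr) (use assms in auto)
  finally show ?thesis by (simp add: add.commute)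
qed

lemma integrable_translation:
  fixes f :: "'a::euclidean_space \<Rightarrow> 'b::{banach, second_countable_topology}"
  assumes "f \<in> borel_measurable borel"
  shows "integrable lborel (\<lambda>z. f (z + c)) \<longleftrightarrow> integrable lborel f"
proof -
  have "integrable lborel f \<longleftrightarrow> integrable (distr lborel borel ((+) c)) f" by (simp add: lborel_distr_plus)
  also have "\<dots> \<longleftrightarrow> integrable lborel (\<lambda>z. f (c + z))" by (rule integrable_distr_eq) (use assms in auto)
  finally show ?thesis by (simp add: add.commute)
qed

text \<open>The difference \<open>F(z + b) - F(z)\<close> has integral zero by translation invariance. It is also the integral
  of \<open>F'(z + s b)\<close> over \<open>0 \<le> s \<le> 1\<close>, and by Fubini and translation invariance again its integral is that
  of \<open>F'\<close>. This replaces boundary terms at infinity.\<close>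
lemma integral_partial_eq_zero:
  fixes F F' :: "'a::euclidean_space \<Rightarrow> 'b::euclidean_space"
  assumes F: "continuous_on UNIV F" "integrable lborel F"
    and F': "continuous_on UNIV F'" "integrable lborel F'"
    and deriv: "\<And>z s. ((\<lambda>t. F (z + t *\<^sub>R b)) has_vector_derivative F' (z + s *\<^sub>R b)) (at s)"
  shows "integral\<^sup>L lborel F' = 0"
proof -
  have meas: "F \<in> borel_measurable borel" "F' \<in> borel_measurable borel"
    using F F' by (auto intro: borel_measurable_continuous_onI)
  note [measurable] = meas
  define H where "H s z = indicator {0..1::real} s *\<^sub>R F' (z + s *\<^sub>R b)" for s z
  have intz: "integrable lborel (\<lambda>z. F' (z + s *\<^sub>R b))" for s
    using integrable_translation[OF meas(2)] F' by blast
  have norm_int: "(LINT z|lborel. norm (F' (z + s *\<^sub>R b))) = (LINT z|lborel. norm (F' z))" for s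
    by (rule integral_translation[of "\<lambda>z. norm (F' z)"]) measurable
  have H_int: "integrable (lborel \<Otimes>\<^sub>M lborel) (case_prod H)"
  proof (rule lborel_pair.Fubini_integrable)
    show "case_prod H \<in> borel_measurable (lborel \<Otimes>\<^sub>M lborel)" unfolding H_def by measurable
    have "(\<lambda>s. LINT z|lborel. norm (case_prod H (s, z))) = (\<lambda>s. indicator {0..1} s *\<^sub>R (LINT z|lborel. norm (F' z)))"
      by (simp add: H_def norm_int fun_eq_iff)
    then show "integrable lborel (\<lambda>s. LINT z|lborel. norm (case_prod H (s, z)))" by simp
    show "AE s in lborel. integrable lborel (\<lambda>z. case_prod H (s, z))"
      using intz by (simp add: H_def)
  qed
  have ind: "(LINT s|lborel. indicator {0..1::real} s *\<^sub>R c) = c" for c :: 'b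
  proof -
    have "(LINT s|lborel. indicator {0..1::real} s *\<^sub>R c) = integral\<^sup>L lborel (indicator {0..1::real}) *\<^sub>R c"
      by (rule integral_scaleR_left) auto
    then show ?thesis by simp
  qed
  have "(LINT s|lborel. LINT z|lborel. H s z) = (LINT s|lborel. indicator {0..1::real} s *\<^sub>R integral\<^sup>L lborel F')"
    by (simp add: H_def integral_translation[OF meas(2)] ind)
  also have "\<dots> = integral\<^sup>L lborel F'"  using ind .
  finally have left: "(LINT s|lborel. LINT z|lborel. H s z) = integral\<^sup>L lborel F'" .
  have "(LINT s|lborel. H s z) = F (z + b) - F z" for z
  proof -
    have "(LINT s|lborel. indicator {0..1} s *\<^sub>R F' (z + s *\<^sub>R b)) = F (z + 1 *\<^sub>R b) - F (z + 0 *\<^sub>R b)"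
    proof (rule integral_FTC_Icc)
      show "continuous_on {0..1} (\<lambda>s. F' (z + s *\<^sub>R b))"
        by (rule continuous_on_compose2[OF F'(1)]) (auto intro!: continuous_intros)
    qed (auto intro!: has_vector_derivative_at_within[OF deriv])
    then show ?thesis by (simp add: H_def)
  qed
  then have "(LINT z|lborel. LINT s|lborel. H s z) = (LINT z|lborel. F (z + b) - F z)" by simp
  also have "\<dots> = 0"
    using integrable_translation[OF meas(1), of b] F(2)
    by (simp add: integral_translation[OF meas(1)])
  finally show ?thesis using left lborel_pair.Fubini_integral[OF H_int] by simp
qed

lemma in_L2_continuous:
  assumes "continuous_on UNIV g"
  shows "in_L2 g \<longleftrightarrow> integrable lborel (\<lambda>z. (cmod (g z))\<^sup>2)"
proof -
  have [measurable]: "g \<in> borel_measurable borel" using assms by (rule borel_measurable_continuous_onI)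
  have "g \<in> borel_measurable lebesgue" by (rule measurable_completion) simp
  moreover have "integrable lebesgue (\<lambda>z. (cmod (g z))\<^sup>2) \<longleftrightarrow> integrable lborel (\<lambda>z. (cmod (g z))\<^sup>2)"
    by (rule integrable_completion) measurable
  ultimately show ?thesis by (simp add: in_L2_def)
qed

lemma L2_norm_continuous:
  assumes "continuous_on UNIV g"
  shows "L2_norm g = sqrt (LINT z|lborel. (cmod (g z))\<^sup>2)"
proof -
  have [measurable]: "g \<in> borel_measurable borel" using assms by (rule borel_measurable_continuous_onI)
  have "(LINT z|lebesgue. (cmod (g z))\<^sup>2) = (LINT z|lborel. (cmod (g z))\<^sup>2)"
    by (rule integral_completion) measurable
  then show ?thesis by (simp add: L2_norm_def)
qed

lemma L2_norm_nonneg: "0 \<le> L2_norm g"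
  by (simp add: L2_norm_def)

lemma smooth_measurable: "smooth g \<Longrightarrow> g \<in> borel_measurable borel"
  by (intro borel_measurable_continuous_onI smooth_imp_continuous)

lemma in_L2_smooth: "smooth g \<Longrightarrow> in_L2 g \<longleftrightarrow> integrable lborel (\<lambda>z. (cmod (g z))\<^sup>2)"
  by (rule in_L2_continuous[OF smooth_imp_continuous])

lemma L2_norm_smooth: "smooth g \<Longrightarrow> (L2_norm g)\<^sup>2 = (LINT z|lborel. (cmod (g z))\<^sup>2)"
  by (subst L2_norm_continuous[OF smooth_imp_continuous]) auto

lemma in_L2_add:
  assumes "smooth f" "smooth g" "in_L2 f" "in_L2 g"
  shows "in_L2 (\<lambda>z. f z + g z)"
proof -
  note [measurable] = smooth_measurable[OF assms(1)] smooth_measurable[OF assms(2)]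
  have int: "integrable lborel (\<lambda>z. 2 * (cmod (f z))\<^sup>2 + 2 * (cmod (g z))\<^sup>2)"
    using assms by (simp add: in_L2_smooth)
  have le: "(cmod (f z + g z))\<^sup>2 \<le> 2 * (cmod (f z))\<^sup>2 + 2 * (cmod (g z))\<^sup>2" for z
  proof -
    have "(cmod (f z + g z))\<^sup>2 \<le> (cmod (f z) + cmod (g z))\<^sup>2"
      by (intro power_mono norm_triangle_ineq) auto
    then show ?thesis using sum_squares_bound[of "cmod (f z)" "cmod (g z)"] by (simp add: power2_sum)
  qed
  have "integrable lborel (\<lambda>z. (cmod (f z + g z))\<^sup>2)"
    by (rule Bochner_Integration.integrable_bound[OF int]) (use le in \<open>auto intro!: order_trans[OF le]\<close>)
  then show ?thesis by (simp add: in_L2_smooth smooth_add assms)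
qed

lemma in_L2_cmult:
  assumes "smooth f" "in_L2 f"
  shows "in_L2 (\<lambda>z. c * f z)"
  using assms by (simp add: in_L2_smooth smooth_cmult norm_mult power_mult_distrib)

lemma in_L2_zero: "in_L2 (\<lambda>_. 0)"
  by (simp add: in_L2_smooth smooth_zero)

lemma borel_measurable_cnj [measurable (raw)]:
  "f \<in> borel_measurable M \<Longrightarrow> (\<lambda>x. cnj (f x)) \<in> borel_measurable M"
  by (rule measurable_compose[OF _ borel_measurable_continuous_onI[OF continuous_on_cnj[OF continuous_on_id]]])

lemma integrable_L2_mult:
  assumes "smooth f" "smooth g" "in_L2 f" "in_L2 g"
  shows "integrable lborel (\<lambda>z. f z * cnj (g z))" "integrable lborel (\<lambda>z. cmod (f z) * cmod (g z))"
proof -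
  note [measurable] = smooth_measurable[OF assms(1)] smooth_measurable[OF assms(2)]
  have int: "integrable lborel (\<lambda>z. (cmod (f z))\<^sup>2 + (cmod (g z))\<^sup>2)"
    using assms by (simp add: in_L2_smooth)
  have le: "cmod (f z) * cmod (g z) \<le> (cmod (f z))\<^sup>2 + (cmod (g z))\<^sup>2" for z
    using sum_squares_bound[of "cmod (f z)" "cmod (g z)"] mult_nonneg_nonneg[of "cmod (f z)" "cmod (g z)"]
    by (simp del: mult_nonneg_nonneg)
  show "integrable lborel (\<lambda>z. f z * cnj (g z))"
    by (rule Bochner_Integration.integrable_bound[OF int]) (use le in \<open>auto simp: norm_mult intro!: order_trans[OF le]\<close>)
  show "integrable lborel (\<lambda>z. cmod (f z) * cmod (g z))"
    by (rule Bochner_Integration.integrable_bound[OF int]) (use le in \<open>auto simp: norm_mult intro!: order_trans[OF le]\<close>)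
qed

definition L2_inner :: "('a::euclidean_space \<Rightarrow> complex) \<Rightarrow> ('a \<Rightarrow> complex) \<Rightarrow> complex" where
  "L2_inner f g = (LINT z|lborel. f z * cnj (g z))"

lemma L2_inner_self:
  assumes "smooth g" shows "L2_inner g g = of_real ((L2_norm g)\<^sup>2)"
proof -
  have "L2_inner g g = (LINT z|lborel. complex_of_real ((cmod (g z))\<^sup>2))"
    unfolding L2_inner_def complex_norm_square ..
  then show ?thesis by (simp only: integral_complex_of_real L2_norm_smooth[OF assms])
qed

lemma L2_inner_cnj: "L2_inner g f = cnj (L2_inner f g)"
proof -
  have "cnj (L2_inner f g) = (LINT z|lborel. cnj (f z * cnj (g z)))"
    unfolding L2_inner_def by (rule Bochner_Integration.integral_cnj[symmetric])
  then show ?thesis by (simp add: L2_inner_def mult.commute)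
qed

lemma L2_cauchy_schwarz:
  assumes "smooth f" "smooth g" "in_L2 f" "in_L2 g"
  shows "cmod (L2_inner f g) \<le> L2_norm f * L2_norm g"
proof -
  note [measurable] = smooth_measurable[OF assms(1)] smooth_measurable[OF assms(2)]
  define X where "X = (LINT z|lborel. cmod (f z) * cmod (g z))"
  have X: "0 \<le> X" by (simp add: X_def)
  have "(\<integral>\<^sup>+z. ennreal (cmod (f z)) * ennreal (cmod (g z)) \<partial>lborel)\<^sup>2
      \<le> (\<integral>\<^sup>+z. ennreal (cmod (f z)) ^ 2 \<partial>lborel) * (\<integral>\<^sup>+z. ennreal (cmod (g z)) ^ 2 \<partial>lborel)"
    by (rule Cauchy_Schwarz_nn_integral) measurable
  also have "(\<integral>\<^sup>+z. ennreal (cmod (f z)) ^ 2 \<partial>lborel) = ennreal ((L2_norm f)\<^sup>2)"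
    unfolding L2_norm_smooth[OF assms(1)] using assms
    by (subst nn_integral_eq_integral[symmetric]) (auto simp: in_L2_smooth ennreal_power)
  also have "(\<integral>\<^sup>+z. ennreal (cmod (g z)) ^ 2 \<partial>lborel) = ennreal ((L2_norm g)\<^sup>2)"
    unfolding L2_norm_smooth[OF assms(2)] using assms
    by (subst nn_integral_eq_integral[symmetric]) (auto simp: in_L2_smooth ennreal_power)
  also have "(\<integral>\<^sup>+z. ennreal (cmod (f z)) * ennreal (cmod (g z)) \<partial>lborel) = ennreal X"
    unfolding X_def using integrable_L2_mult(2)[OF assms]
    by (subst nn_integral_eq_integral[symmetric]) (auto simp: ennreal_mult)
  finally have "ennreal (X\<^sup>2) \<le> ennreal ((L2_norm f * L2_norm g)\<^sup>2)"
    using X by (simp add: ennreal_power ennreal_mult[symmetric] power_mult_distrib)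
  then have "X\<^sup>2 \<le> (L2_norm f * L2_norm g)\<^sup>2" by (subst (asm) ennreal_le_iff) auto
  then have "X \<le> L2_norm f * L2_norm g"
    by (rule power2_le_imp_le) (simp add: L2_norm_nonneg)
  moreover have "cmod (L2_inner f g) \<le> X"
    unfolding L2_inner_def X_def
    by (rule order_trans[OF integral_norm_bound]) (simp add: norm_mult)
  ultimately show ?thesis by linarith
qed

text \<open>The potential terms are imaginary multiples of the same product with opposite signs, so they cancel;
  magnetic derivatives obey the Leibniz rule for sesquilinear products.\<close>
lemma magnetic_product_has_derivative:
  assumes "smooth g" "smooth h" "b \<in> Basis"
  shows "((\<lambda>t. g (z + t *\<^sub>R b) * cnj (h (z + t *\<^sub>R b))) has_vector_derivative
     magnetic_deriv K b g (z + s *\<^sub>R b) * cnj (h (z + s *\<^sub>R b))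
     + g (z + s *\<^sub>R b) * cnj (magnetic_deriv K b h (z + s *\<^sub>R b))) (at s)"
proof -
  have "((\<lambda>t. cnj (h (z + t *\<^sub>R b))) has_vector_derivative cnj (partial_deriv b h (z + s *\<^sub>R b))) (at s)"
    by (rule has_vector_derivative_cnj[OF smooth_has_partial[OF assms(2,3)]])
  from has_vector_derivative_mult[OF smooth_has_partial[OF assms(1,3)] this]
  show ?thesis by (rule has_vector_derivative_eq_rhs) (simp add: magnetic_deriv_def algebra_simps)
qed

lemma magnetic_integration_by_parts:
  assumes g: "smooth g" "in_L2 g" "in_L2 (magnetic_deriv K b g)"
    and h: "smooth h" "in_L2 h" "in_L2 (magnetic_deriv K b h)" and b: "b \<in> Basis"
  shows "L2_inner (magnetic_deriv K b g) h = - L2_inner g (magnetic_deriv K b h)"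
proof -
  note sm = smooth_magnetic_deriv[OF g(1) b, of K] smooth_magnetic_deriv[OF h(1) b, of K]
  note cont = g(1)[THEN smooth_imp_continuous] h(1)[THEN smooth_imp_continuous]
    sm(1)[THEN smooth_imp_continuous] sm(2)[THEN smooth_imp_continuous]
  note int = integrable_L2_mult(1)[OF sm(1) h(1) g(3) h(2)] integrable_L2_mult(1)[OF g(1) sm(2) g(2) h(3)]
  have "(LINT z|lborel. magnetic_deriv K b g z * cnj (h z) + g z * cnj (magnetic_deriv K b h z)) = 0"
  proof (rule integral_partial_eq_zero[where F = "\<lambda>z. g z * cnj (h z)" and b = b])
    show "continuous_on UNIV (\<lambda>z. g z * cnj (h z))"
      using cont by (intro continuous_intros)
    show "continuous_on UNIV (\<lambda>z. magnetic_deriv K b g z * cnj (h z) + g z * cnj (magnetic_deriv K b h z))"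
      using cont by (intro continuous_intros)
    show "integrable lborel (\<lambda>z. g z * cnj (h z))" by (rule integrable_L2_mult(1)[OF g(1) h(1) g(2) h(2)])
    show "integrable lborel (\<lambda>z. magnetic_deriv K b g z * cnj (h z) + g z * cnj (magnetic_deriv K b h z))"
      by (rule Bochner_Integration.integrable_add[OF int])
  qed (rule magnetic_product_has_derivative[OF g(1) h(1) b])
  then show ?thesis unfolding L2_inner_def Bochner_Integration.integral_add[OF int] by (simp add: add_eq_0_iff2)
qed

section \<open>Square integrability of magnetic derivatives\<close>

text \<open>The square gives a compactly supported continuously differentiable function whose gradient is at most a
  multiple of \<open>sqrt (cutoff R z) / R\<close>, which is what the energy estimate needs in order to absorb the
  gradient term.\<close>
definition cutoff :: "real \<Rightarrow> 'a::euclidean_space \<Rightarrow> real" where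
  "cutoff R z = (max 0 (1 - (norm z)\<^sup>2 / R\<^sup>2))\<^sup>2"

definition cutoff_deriv :: "real \<Rightarrow> 'a \<Rightarrow> 'a::euclidean_space \<Rightarrow> real" where
  "cutoff_deriv R b z = 2 * max 0 (1 - (norm z)\<^sup>2 / R\<^sup>2) * (- 2 * (z \<bullet> b) / R\<^sup>2)"

lemma positive_part_squared_has_derivative:
  "((\<lambda>x. (max 0 x)\<^sup>2) has_real_derivative 2 * max 0 x) (at x)"
proof (cases x "0::real" rule: linorder_cases)
  case less
  have "((\<lambda>x::real. 0) has_real_derivative 0) (at x)" by simp
  then have "((\<lambda>x. (max 0 x)\<^sup>2) has_real_derivative 0) (at x)"
    by (rule DERIV_cong_ev[THEN iffD1, rotated -1, OF _ refl _ refl])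
      (use less in \<open>auto intro!: eventually_mono[OF order_tendstoD(2)[OF tendsto_ident_at]] simp: eventually_nhds intro: exI[of _ "{..<0}"]\<close>)
  with less show ?thesis by simp
next
  case greater
  have "((\<lambda>x::real. x\<^sup>2) has_real_derivative 2 * x) (at x)" by (auto intro!: derivative_eq_intros)
  then have "((\<lambda>x. (max 0 x)\<^sup>2) has_real_derivative 2 * x) (at x)"
    by (rule DERIV_cong_ev[THEN iffD1, rotated -1, OF _ refl _ refl])
      (use greater in \<open>auto simp: eventually_nhds intro!: exI[of _ "{0<..}"]\<close>)
  with greater show ?thesis by simp
next
  case equal
  have "((\<lambda>h::real. max 0 h) \<longlongrightarrow> 0) (at 0)" by (auto intro!: tendsto_eq_intros)
  then have "((\<lambda>h::real. ((max 0 (0 + h))\<^sup>2 - (max 0 0)\<^sup>2) / h) \<longlongrightarrow> 0) (at 0)"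
    by (rule Lim_transform_eventually) (auto simp: eventually_at_filter max_def power2_eq_square)
  then show ?thesis using equal by (simp add: DERIV_def)
qed

lemma cutoff_has_derivative:
  "((\<lambda>t. cutoff R (z + t *\<^sub>R b)) has_real_derivative cutoff_deriv R b (z + s *\<^sub>R b)) (at s)"
proof -
  have "((\<lambda>t. 1 - c * (norm (z + t *\<^sub>R b))\<^sup>2) has_real_derivative (- 2 * ((z + s *\<^sub>R b) \<bullet> b) * c)) (at s)" for c
    unfolding power2_norm_eq_inner inner_add_left inner_add_right inner_scaleR_left inner_scaleR_right
    by (auto intro!: derivative_eq_intros simp: algebra_simps inner_commute)
  from this[of "1 / R\<^sup>2"]
  have "((\<lambda>t. 1 - (norm (z + t *\<^sub>R b))\<^sup>2 / R\<^sup>2) has_real_derivative (- 2 * ((z + s *\<^sub>R b) \<bullet> b) / R\<^sup>2)) (at s)"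
    by simp
  from DERIV_chain2[OF positive_part_squared_has_derivative this]
  show ?thesis by (simp add: cutoff_def cutoff_deriv_def)
qed

lemma cutoff_bounds:
  assumes "0 < R"
  shows "0 \<le> cutoff R z" "cutoff R z \<le> 1" "R < norm z \<Longrightarrow> cutoff R z = 0"
  using assms by (auto simp: cutoff_def power_le_one max_def abs_square_le_1 divide_le_eq field_simps power_strict_mono not_le)

lemma cutoff_deriv_bound:
  assumes R: "0 < R" and b: "norm b = 1"
  shows "\<bar>cutoff_deriv R b z\<bar> \<le> 4 / R * sqrt (cutoff R z)"
proof (cases "norm z \<le> R")
  case True
  have "\<bar>z \<bullet> b\<bar> \<le> R" using Cauchy_Schwarz_ineq2[of z b] b True by simp
  have "\<bar>cutoff_deriv R b z\<bar> = (4 * \<bar>z \<bullet> b\<bar> / R\<^sup>2) * max 0 (1 - (norm z)\<^sup>2 / R\<^sup>2)"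
    by (simp add: cutoff_deriv_def abs_mult)
  also have "\<dots> \<le> (4 * R / R\<^sup>2) * max 0 (1 - (norm z)\<^sup>2 / R\<^sup>2)"
    using \<open>\<bar>z \<bullet> b\<bar> \<le> R\<close> R by (intro mult_right_mono divide_right_mono) auto
  also have "\<dots> = 4 / R * sqrt (cutoff R z)" using R by (simp add: cutoff_def power2_eq_square)
  finally show ?thesis .
next
  case False
  then have "(norm z)\<^sup>2 / R\<^sup>2 > 1" using R by (simp add: power_strict_mono)
  then show ?thesis by (simp add: cutoff_deriv_def cutoff_def max_def)
qed

lemma cutoff_tendsto_1: "(\<lambda>k. cutoff (real (Suc k)) z) \<longlonglongrightarrow> 1"
proof -
  have "(\<lambda>k. (norm z)\<^sup>2 * (inverse (real (Suc k)))\<^sup>2) \<longlonglongrightarrow> (norm z)\<^sup>2 * 0\<^sup>2"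
    by (intro tendsto_intros LIMSEQ_inverse_real_of_nat)
  from tendsto_power[OF tendsto_max[OF tendsto_const tendsto_diff[OF tendsto_const this]], of 0 1 2]
  show ?thesis by (simp add: cutoff_def divide_inverse power_inverse)
qed

lemma continuous_cutoff: "continuous_on UNIV (cutoff R)" "continuous_on UNIV (cutoff_deriv R b)"
  unfolding cutoff_def[abs_def] cutoff_deriv_def[abs_def] divide_inverse by (intro continuous_intros)+

text \<open>Integrate \<open>\<Sum> \<partial>\<^sub>b (\<eta> D\<^sub>b g g\<^sup>*)\<close>, which has integral zero, with the cutoff \<open>\<eta>\<close>. It is the sum of the
  energy \<open>\<eta> |Dg|\<^sup>2\<close>, of \<open>-\<eta> Lg g\<^sup>*\<close>, and of terms with the gradient of \<open>\<eta>\<close>; half of the energy absorbs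
  the latter. The bound does not depend on \<open>R\<close>.\<close>
lemma magnetic_energy_cutoff:
  fixes g :: "'a::euclidean_space \<Rightarrow> complex"
  assumes g: "smooth g" and R: "1 \<le> R"
    and L2: "in_L2 g" "in_L2 (magnetic_laplacian K g)"
  shows "(\<integral>\<^sup>+z. ennreal (cutoff R z * (\<Sum>b\<in>Basis. (cmod (magnetic_deriv K b g z))\<^sup>2)) \<partial>lborel)
    \<le> ennreal (LINT z|lborel. (cmod (magnetic_laplacian K g z))\<^sup>2 + (1 + 16 * real DIM('a)) * (cmod (g z))\<^sup>2)"
proof -
  let ?D = "magnetic_deriv K" and ?L = "magnetic_laplacian K g"
  define F where "F b z = of_real (cutoff R z) * (?D b g z * cnj (g z))" for b z
  define F' where "F' b z = of_real (cutoff R z) * (?D b (?D b g) z * cnj (g z) + ?D b g z * cnj (?D b g z))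
      + of_real (cutoff_deriv R b z) * (?D b g z * cnj (g z))" for b z
  define e where "e z = (\<Sum>b\<in>Basis. (cmod (?D b g z))\<^sup>2)" for z
  define G where "G z = (cmod (?L z))\<^sup>2 + (1 + 16 * real DIM('a)) * (cmod (g z))\<^sup>2" for z
  have R0: "0 < R" using R by simp
  have cont: "continuous_on UNIV g" "continuous_on UNIV ?L"
    "b \<in> Basis \<Longrightarrow> continuous_on UNIV (?D b g)" "b \<in> Basis \<Longrightarrow> continuous_on UNIV (?D b (?D b g))" for b
    by (intro smooth_imp_continuous smooth_magnetic_laplacian smooth_magnetic_deriv g; assumption)+
  have outside: "cutoff R z = 0" "cutoff_deriv R b z = 0" if "R < norm z" for b z :: 'a
  proof -
    have "1 < (norm z)\<^sup>2 / R\<^sup>2" using that R0 by (simp add: power_strict_mono)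
    then show "cutoff R z = 0" "cutoff_deriv R b z = 0" by (simp_all add: cutoff_deriv_def cutoff_def)
  qed
  have compact_int: "integrable lborel H"
    if H: "continuous_on UNIV H" "\<And>z. R < norm z \<Longrightarrow> H z = 0" for H :: "'a \<Rightarrow> 'b::{banach, second_countable_topology}"
  proof -
    have "integrable lborel (\<lambda>x. indicator (cball 0 R) x *\<^sub>R H x)"
      by (intro borel_integrable_compact continuous_on_subset[OF H(1)]) auto
    also have "(\<lambda>x. indicator (cball 0 R) x *\<^sub>R H x) = H"
      using H(2) by (auto simp: fun_eq_iff indicator_def not_le)
    finally show ?thesis .
  qed
  have contF: "continuous_on UNIV (F b)" "continuous_on UNIV (F' b)" if "b \<in> Basis" for b
    unfolding F_def[abs_def] F'_def[abs_def]
    using cont(1) cont(3,4)[OF that] continuous_cutoff[of R] continuous_cutoff(2)[of R b]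
    by (intro continuous_intros; simp)+
  have intF: "integrable lborel (F b)" "integrable lborel (F' b)" if "b \<in> Basis" for b
    by (rule compact_int[OF contF(1)[OF that]], simp add: F_def outside,
        rule compact_int[OF contF(2)[OF that]], simp add: F'_def outside)
  have zero: "integral\<^sup>L lborel (F' b) = 0" if b: "b \<in> Basis" for b
  proof (rule integral_partial_eq_zero[where F = "F b" and b = b])
    fix z s
    have "((\<lambda>t. complex_of_real (cutoff R (z + t *\<^sub>R b))) has_vector_derivative
        of_real (cutoff_deriv R b (z + s *\<^sub>R b))) (at s)"
      using cutoff_has_derivative[of R z b s]
      by (intro has_vector_derivative_of_real) (simp add: has_real_derivative_iff_has_vector_derivative)
    from has_vector_derivative_mult[OF this magnetic_product_has_derivative[OF smooth_magnetic_deriv[OF g b] g b]]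
    show "((\<lambda>t. F b (z + t *\<^sub>R b)) has_vector_derivative F' b (z + s *\<^sub>R b)) (at s)"
      unfolding F_def F'_def .
  qed (use contF intF b in auto)
  have pointwise: "cutoff R z * e z \<le> 2 * (\<Sum>b\<in>Basis. Re (F' b z)) + G z" for z
  proof -
    let ?c = "cutoff R z" and ?a = "cmod (g z)"
    have c01: "0 \<le> ?c" "?c \<le> 1" using cutoff_bounds[OF R0] by auto
    have split: "(\<Sum>b\<in>Basis. Re (F' b z)) = ?c * Re (- ?L z * cnj (g z)) + ?c * e z
        + (\<Sum>b\<in>Basis. cutoff_deriv R b z * Re (?D b g z * cnj (g z)))"
    proof -
      have "Re (F' b z) = ?c * Re (?D b (?D b g) z * cnj (g z)) + ?c * (cmod (?D b g z))\<^sup>2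
        + cutoff_deriv R b z * Re (?D b g z * cnj (g z))" for b
        unfolding F'_def complex_norm_square[symmetric] by (simp add: algebra_simps)
      moreover have "- ?L z * cnj (g z) = (\<Sum>b\<in>Basis. ?D b (?D b g) z * cnj (g z))"
        by (simp add: magnetic_laplacian_def sum_distrib_right)
      then have "Re (- ?L z * cnj (g z)) = (\<Sum>b\<in>Basis. Re (?D b (?D b g) z * cnj (g z)))"
        by (simp only: Re_sum)
      ultimately show ?thesis by (simp only: sum.distrib sum_distrib_left[symmetric] e_def)
    qed
    have laplacian: "?c * Re (- ?L z * cnj (g z)) \<ge> - ((cmod (?L z))\<^sup>2 + ?a\<^sup>2) / 2"
    proof -
      have "\<bar>?c * Re (- ?L z * cnj (g z))\<bar> \<le> 1 * (cmod (?L z) * ?a)"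
        unfolding abs_mult using c01 abs_Re_le_cmod[of "- ?L z * cnj (g z)"]
        by (intro mult_mono) (auto simp: norm_mult)
      then show ?thesis using sum_squares_bound[of "cmod (?L z)" ?a] by (simp add: abs_le_iff)
    qed
    \<comment> \<open>\<open>4 sqrt \<eta> |D\<^sub>b g| |g| \<le> \<eta> |D\<^sub>b g|\<^sup>2 / 2 + 8 |g|\<^sup>2\<close>\<close>
    have gradient: "(\<Sum>b\<in>Basis. cutoff_deriv R b z * Re (?D b g z * cnj (g z)))
        \<ge> (\<Sum>b\<in>Basis. - (?c * (cmod (?D b g z))\<^sup>2 / 2 + 8 * ?a\<^sup>2))"
    proof (rule sum_mono)
      fix b :: 'a assume "b \<in> Basis"
      then have "\<bar>cutoff_deriv R b z\<bar> \<le> 4 / R * sqrt ?c" by (intro cutoff_deriv_bound R0) auto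
      also have "\<dots> \<le> 4 * sqrt ?c" using R c01 by (intro mult_right_mono) (auto simp: divide_le_eq)
      finally have "\<bar>cutoff_deriv R b z * Re (?D b g z * cnj (g z))\<bar> \<le> 4 * sqrt ?c * (cmod (?D b g z) * ?a)"
        unfolding abs_mult using abs_Re_le_cmod[of "?D b g z * cnj (g z)"] c01
        by (intro mult_mono) (auto simp: norm_mult)
      also have "\<dots> \<le> ?c * (cmod (?D b g z))\<^sup>2 / 2 + 8 * ?a\<^sup>2"
        using sum_squares_bound[of "sqrt ?c * cmod (?D b g z)" "4 * ?a"] c01
        by (simp add: power_mult_distrib algebra_simps)
      finally show "- (?c * (cmod (?D b g z))\<^sup>2 / 2 + 8 * ?a\<^sup>2) \<le> cutoff_deriv R b z * Re (?D b g z * cnj (g z))"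
        by (simp add: abs_le_iff)
    qed
    have total: "(\<Sum>b\<in>Basis. - (?c * (cmod (?D b g z))\<^sup>2 / 2 + 8 * ?a\<^sup>2))
        = - (?c * e z / 2) - 8 * (real DIM('a) * ?a\<^sup>2)"
      by (simp add: e_def sum_negf sum.distrib sum_subtractf sum_distrib_left sum_divide_distrib)
    have G: "G z = (cmod (?L z))\<^sup>2 + ?a\<^sup>2 + 16 * (real DIM('a) * ?a\<^sup>2)"
      by (simp add: G_def algebra_simps)
    have "q \<le> 2 * p + (l + a + 16 * n)"
      if "p = A + q + B" "- (l + a) / 2 \<le> A" "- (q / 2) - 8 * n \<le> B" for p q A B l a n :: real
      using that by (simp add: field_simps)
    from this[OF split laplacian gradient[unfolded total]] show ?thesis unfolding G .
  qed
  have intG: "integrable lborel G"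
    unfolding G_def using L2 g by (simp add: in_L2_smooth smooth_magnetic_laplacian)
  have conte: "continuous_on UNIV e"
    unfolding e_def[abs_def] using cont(3) by (intro continuous_intros) auto
  have intce: "integrable lborel (\<lambda>z. cutoff R z * e z)"
  proof (rule compact_int)
    show "continuous_on UNIV (\<lambda>z. cutoff R z * e z)" using conte continuous_cutoff(1)[of R] by (rule continuous_on_mult[rotated])
  qed (simp add: outside)
  have e_nonneg: "0 \<le> e z" for z by (simp add: e_def sum_nonneg)
  have intRe: "integrable lborel (\<lambda>z. Re (F' b z))" if "b \<in> Basis" for b
    using intF(2)[OF that] by (rule integrable_Re)
  have "(LINT z|lborel. cutoff R z * e z) \<le> (LINT z|lborel. 2 * (\<Sum>b\<in>Basis. Re (F' b z)) + G z)"
    using intRe intG by (intro integral_mono intce pointwise) auto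
  also have "\<dots> = 2 * (\<Sum>b\<in>Basis. LINT z|lborel. Re (F' b z)) + integral\<^sup>L lborel G"
    using intRe intG by simp
  also have "(\<Sum>b\<in>Basis. LINT z|lborel. Re (F' b z)) = 0"
  proof (intro sum.neutral ballI)
    fix b :: 'a assume b: "b \<in> Basis"
    show "(LINT z|lborel. Re (F' b z)) = 0" using integral_Re[OF intF(2)[OF b]] zero[OF b] by simp
  qed
  finally have "(LINT z|lborel. cutoff R z * e z) \<le> integral\<^sup>L lborel G" by simp
  moreover have "(\<integral>\<^sup>+z. ennreal (cutoff R z * e z) \<partial>lborel) = ennreal (LINT z|lborel. cutoff R z * e z)"
    by (intro nn_integral_eq_integral AE_I2 mult_nonneg_nonneg intce e_nonneg cutoff_bounds(1)[OF R0])
  ultimately show ?thesis unfolding e_def[symmetric] G_def[symmetric] by (simp add: ennreal_leI)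
qed

text \<open>Let \<open>R\<close> tend to infinity in the previous estimate, with Fatou's lemma.\<close>
lemma magnetic_deriv_in_L2:
  fixes g :: "'a::euclidean_space \<Rightarrow> complex"
  assumes g: "smooth g" and L2: "in_L2 g" "in_L2 (magnetic_laplacian K g)" and b: "b \<in> Basis"
  shows "in_L2 (magnetic_deriv K b g)"
proof -
  let ?D = "magnetic_deriv K"
  define e where "e z = (\<Sum>b\<in>Basis. (cmod (?D b g z))\<^sup>2)" for z
  define I where "I = (LINT z|lborel. (cmod (magnetic_laplacian K g z))\<^sup>2 + (1 + 16 * real DIM('a)) * (cmod (g z))\<^sup>2)"
  have conte: "continuous_on UNIV e"
    unfolding e_def[abs_def] using smooth_imp_continuous[OF smooth_magnetic_deriv[OF g]]
    by (intro continuous_intros) auto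
  have [measurable]: "e \<in> borel_measurable borel" "cutoff R \<in> borel_measurable borel" for R :: real
    by (intro borel_measurable_continuous_onI conte continuous_cutoff)+
  have [measurable]: "?D b g \<in> borel_measurable borel"
    by (rule smooth_measurable[OF smooth_magnetic_deriv[OF g b]])
  have "(\<integral>\<^sup>+z. ennreal (e z) \<partial>lborel) = (\<integral>\<^sup>+z. liminf (\<lambda>k. ennreal (cutoff (real (Suc k)) z * e z)) \<partial>lborel)"
  proof (rule nn_integral_cong)
    fix z :: 'a
    have "(\<lambda>k. ennreal (cutoff (real (Suc k)) z * e z)) \<longlonglongrightarrow> ennreal (1 * e z)"
      by (intro tendsto_ennrealI tendsto_mult_right cutoff_tendsto_1)
    from lim_imp_Liminf[OF _ this]
    show "ennreal (e z) = liminf (\<lambda>k. ennreal (cutoff (real (Suc k)) z * e z))" by simp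
  qed
  also have "\<dots> \<le> liminf (\<lambda>k. \<integral>\<^sup>+z. ennreal (cutoff (real (Suc k)) z * e z) \<partial>lborel)"
    by (rule nn_integral_liminf) measurable
  also have "\<dots> \<le> ennreal I"
    using magnetic_energy_cutoff[OF g _ L2] by (intro Liminf_le always_eventually allI) (auto simp: e_def I_def)
  finally have fin: "(\<integral>\<^sup>+z. ennreal (e z) \<partial>lborel) \<le> ennreal I" .
  have e_nonneg: "0 \<le> e z" for z by (simp add: e_def sum_nonneg)
  have "integrable lborel e"
    using fin e_nonneg by (intro integrableI_nonneg) (auto simp: less_top[symmetric] top_unique)
  then have "integrable lborel (\<lambda>z. (cmod (?D b g z))\<^sup>2)"
  proof (rule Bochner_Integration.integrable_bound)
    show "(\<lambda>z. (cmod (?D b g z))\<^sup>2) \<in> borel_measurable lborel" by measurable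
    have "(cmod (?D b g z))\<^sup>2 \<le> e z" for z
      unfolding e_def using b by (intro member_le_sum) auto
    then have "norm ((cmod (?D b g z))\<^sup>2) \<le> norm (e z)" for z
      using e_nonneg[of z] by (metis abs_of_nonneg real_norm_def zero_le_power2)
    then show "AE z in lborel. norm ((cmod (?D b g z))\<^sup>2) \<le> norm (e z)" by simp
  qed
  then show ?thesis by (simp add: in_L2_smooth smooth_magnetic_deriv g b)
qed

text \<open>The Sobolev space of order \<open>m\<close> with respect to magnetic derivatives, restricted to smooth functions.
  The recursion peels off the innermost derivative, which suits the commutator formula
  \<open>magnetic_laplacian_deriv\<close>.\<close>
primrec magnetic_sobolev :: "('a::euclidean_space \<Rightarrow> 'a) \<Rightarrow> nat \<Rightarrow> ('a \<Rightarrow> complex) \<Rightarrow> bool" where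
  "magnetic_sobolev K 0 g \<longleftrightarrow> smooth g \<and> in_L2 g"
| "magnetic_sobolev K (Suc m) g \<longleftrightarrow>
    smooth g \<and> in_L2 g \<and> (\<forall>b\<in>Basis. magnetic_sobolev K m (magnetic_deriv K b g))"

lemma magnetic_sobolev_base: "magnetic_sobolev K m g \<Longrightarrow> smooth g \<and> in_L2 g"
  by (cases m) auto

lemma magnetic_sobolev_add:
  "magnetic_sobolev K m f \<Longrightarrow> magnetic_sobolev K m g \<Longrightarrow> magnetic_sobolev K m (\<lambda>z. f z + g z)"
  by (induction m arbitrary: f g) (auto simp: smooth_add in_L2_add magnetic_deriv_add)

lemma magnetic_sobolev_cmult:
  "magnetic_sobolev K m f \<Longrightarrow> magnetic_sobolev K m (\<lambda>z. c * f z)"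
  by (induction m arbitrary: f) (auto simp: smooth_cmult in_L2_cmult magnetic_deriv_cmult)

lemma magnetic_sobolev_zero: "magnetic_sobolev K m (\<lambda>_. 0)"
  by (induction m) (auto simp: smooth_zero in_L2_zero magnetic_deriv_zero)

lemma magnetic_sobolev_sum:
  "(\<And>i. i \<in> I \<Longrightarrow> magnetic_sobolev K m (f i)) \<Longrightarrow> magnetic_sobolev K m (\<lambda>z. \<Sum>i\<in>I. f i z)"
  by (induction I rule: infinite_finite_induct) (auto intro: magnetic_sobolev_add magnetic_sobolev_zero)

text \<open>For \<open>m > 0\<close> apply the induction hypothesis to \<open>D\<^sub>b g\<close>: its Laplacian is \<open>D\<^sub>b (L g)\<close> plus a combination of first
  derivatives of \<open>g\<close>. The gain is one order rather than two, but it is available for all powers of \<open>L\<close>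
  simultaneously, so it can be iterated.\<close>
lemma magnetic_elliptic_gain:
  assumes "magnetic_sobolev K m g" "magnetic_sobolev K m (magnetic_laplacian K g)"
  shows "magnetic_sobolev K (Suc m) g"
  using assms
proof (induction m arbitrary: g)
  case 0
  then show ?case by (auto intro: smooth_magnetic_deriv magnetic_deriv_in_L2)
next
  case (Suc m)
  have g: "smooth g" "in_L2 g" using Suc.prems by auto
  have "magnetic_sobolev K (Suc m) (magnetic_deriv K b g)" if b: "b \<in> Basis" for b
  proof (rule Suc.IH)
    show "magnetic_sobolev K m (magnetic_deriv K b g)" using Suc.prems b by simp
    show "magnetic_sobolev K m (magnetic_laplacian K (magnetic_deriv K b g))"
      unfolding magnetic_laplacian_deriv[OF g(1) b]
      by (intro magnetic_sobolev_add magnetic_sobolev_sum magnetic_sobolev_cmult) (use Suc.prems b in auto)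
  qed
  then show ?case using g by simp
qed

lemma magnetic_elliptic_regularity:
  assumes "\<And>k. smooth ((magnetic_laplacian K ^^ k) f)" "\<And>k. in_L2 ((magnetic_laplacian K ^^ k) f)"
  shows "magnetic_sobolev K m ((magnetic_laplacian K ^^ k) f)"
proof (induction m arbitrary: k)
  case 0 then show ?case using assms by simp
next
  case (Suc m)
  have "magnetic_sobolev K m (magnetic_laplacian K ((magnetic_laplacian K ^^ k) f))"
    using Suc.IH[of "Suc k"] by simp
  then show ?case by (rule magnetic_elliptic_gain[OF Suc.IH])
qed

definition sobolev_smooth :: "('a::euclidean_space \<Rightarrow> 'a) \<Rightarrow> ('a \<Rightarrow> complex) \<Rightarrow> bool" where
  "sobolev_smooth K g \<longleftrightarrow> (\<forall>m. magnetic_sobolev K m g)"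

lemma sobolev_smoothD:
  assumes "sobolev_smooth K g" shows "smooth g" "in_L2 g"
  using assms magnetic_sobolev_base unfolding sobolev_smooth_def by blast+

lemma sobolev_smooth_deriv: "sobolev_smooth K g \<Longrightarrow> b \<in> Basis \<Longrightarrow> sobolev_smooth K (magnetic_deriv K b g)"
  unfolding sobolev_smooth_def by (metis magnetic_sobolev.simps(2))

lemma sobolev_smooth_cmult: "sobolev_smooth K g \<Longrightarrow> sobolev_smooth K (\<lambda>z. c * g z)"
  unfolding sobolev_smooth_def by (blast intro: magnetic_sobolev_cmult)

lemma sobolev_smooth_sum:
  "(\<And>i. i \<in> I \<Longrightarrow> sobolev_smooth K (f i)) \<Longrightarrow> sobolev_smooth K (\<lambda>z. \<Sum>i\<in>I. f i z)"
  unfolding sobolev_smooth_def by (blast intro: magnetic_sobolev_sum)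

lemma sobolev_smooth_laplacian:
  assumes "sobolev_smooth K g" shows "sobolev_smooth K (magnetic_laplacian K g)"
proof -
  have "sobolev_smooth K (\<lambda>z. (-1) * (\<Sum>b\<in>Basis. magnetic_deriv K b (magnetic_deriv K b g) z))"
    by (intro sobolev_smooth_cmult sobolev_smooth_sum sobolev_smooth_deriv assms)
  then show ?thesis by (simp add: magnetic_laplacian_def[abs_def])
qed

section \<open>Sobolev seminorms and powers of the Laplacian\<close>

text \<open>The sum of \<open>\<langle>D\<^sub>w g, D\<^sub>w h\<rangle>\<close> over all words \<open>w\<close> of length \<open>m\<close> in the coordinate directions;
  \<open>sobolev_norm\<close> is the associated seminorm.\<close>
primrec sobolev_inner ::
    "('a::euclidean_space \<Rightarrow> 'a) \<Rightarrow> nat \<Rightarrow> ('a \<Rightarrow> complex) \<Rightarrow> ('a \<Rightarrow> complex) \<Rightarrow> complex" where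
  "sobolev_inner K 0 g h = L2_inner g h"
| "sobolev_inner K (Suc m) g h =
    (\<Sum>b\<in>Basis. sobolev_inner K m (magnetic_deriv K b g) (magnetic_deriv K b h))"

primrec sobolev_norm :: "('a::euclidean_space \<Rightarrow> 'a) \<Rightarrow> nat \<Rightarrow> ('a \<Rightarrow> complex) \<Rightarrow> real" where
  "sobolev_norm K 0 g = L2_norm g"
| "sobolev_norm K (Suc m) g = L2_set (\<lambda>b. sobolev_norm K m (magnetic_deriv K b g)) Basis"

lemma sobolev_norm_nonneg: "0 \<le> sobolev_norm K m g"
  by (cases m) (auto simp: L2_norm_nonneg)

lemma sobolev_norm_deriv_le:
  "b \<in> Basis \<Longrightarrow> sobolev_norm K m (magnetic_deriv K b g) \<le> sobolev_norm K (Suc m) g"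
  by (simp add: member_le_L2_set[where f = "\<lambda>b. sobolev_norm K m (magnetic_deriv K b g)"])

lemma sobolev_inner_self:
  "smooth g \<Longrightarrow> sobolev_inner K m g g = of_real ((sobolev_norm K m g)\<^sup>2)"
  by (induction m arbitrary: g)
    (auto simp: L2_inner_self L2_set_def sum_nonneg smooth_magnetic_deriv)

lemma sobolev_inner_cnj: "sobolev_inner K m h g = cnj (sobolev_inner K m g h)"
proof (induction m arbitrary: g h)
  case 0
  show ?case using L2_inner_cnj[of h g] by simp
next
  case (Suc m)
  show ?case by (simp only: sobolev_inner.simps cnj_sum Suc[symmetric])
qed

lemma sobolev_cauchy_schwarz:
  "sobolev_smooth K g \<Longrightarrow> sobolev_smooth K h \<Longrightarrow>
    cmod (sobolev_inner K m g h) \<le> sobolev_norm K m g * sobolev_norm K m h"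
proof (induction m arbitrary: g h)
  case 0
  then show ?case by (simp add: L2_cauchy_schwarz sobolev_smoothD)
next
  case (Suc m)
  let ?D = "magnetic_deriv K"
  have "cmod (sobolev_inner K (Suc m) g h) \<le> (\<Sum>b\<in>Basis. cmod (sobolev_inner K m (?D b g) (?D b h)))"
    unfolding sobolev_inner.simps by (rule norm_sum)
  also have "\<dots> \<le> (\<Sum>b\<in>Basis. \<bar>sobolev_norm K m (?D b g)\<bar> * \<bar>sobolev_norm K m (?D b h)\<bar>)"
    using Suc.IH Suc.prems by (intro sum_mono) (simp add: sobolev_norm_nonneg sobolev_smooth_deriv)
  also have "\<dots> \<le> sobolev_norm K (Suc m) g * sobolev_norm K (Suc m) h"
    unfolding sobolev_norm.simps by (rule L2_set_mult_ineq)
  finally show ?case .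
qed

lemma sobolev_inner_add_left:
  "sobolev_smooth K f \<Longrightarrow> sobolev_smooth K g \<Longrightarrow> sobolev_smooth K h \<Longrightarrow>
    sobolev_inner K m (\<lambda>z. f z + g z) h = sobolev_inner K m f h + sobolev_inner K m g h"
proof (induction m arbitrary: f g h)
  case 0
  then show ?case
    by (simp add: L2_inner_def distrib_right integrable_L2_mult sobolev_smoothD)
next
  case (Suc m)
  then show ?case
    by (simp add: magnetic_deriv_add sobolev_smoothD sobolev_smooth_deriv sum.distrib)
qed

lemma sobolev_inner_cmult_left:
  "sobolev_smooth K f \<Longrightarrow> sobolev_inner K m (\<lambda>z. c * f z) h = c * sobolev_inner K m f h"
proof (induction m arbitrary: f h)
  case 0
  then show ?case by (simp add: L2_inner_def mult.assoc)
next
  case (Suc m)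
  then show ?case
    by (simp add: magnetic_deriv_cmult sobolev_smoothD sobolev_smooth_deriv sum_distrib_left)
qed

lemma sobolev_inner_zero_left: "sobolev_inner K m (\<lambda>_. 0) h = 0"
  by (induction m arbitrary: h) (simp_all add: L2_inner_def magnetic_deriv_zero)

lemma sobolev_inner_sum_left:
  "(\<And>i. i \<in> I \<Longrightarrow> sobolev_smooth K (f i)) \<Longrightarrow> sobolev_smooth K h \<Longrightarrow>
    sobolev_inner K m (\<lambda>z. \<Sum>i\<in>I. f i z) h = (\<Sum>i\<in>I. sobolev_inner K m (f i) h)"
  by (induction I rule: infinite_finite_induct)
    (simp_all add: sobolev_inner_zero_left sobolev_inner_add_left sobolev_smooth_sum)

lemma sobolev_inner_energy:
  assumes g: "sobolev_smooth K g" and h: "sobolev_smooth K h"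
  shows "sobolev_inner K (Suc 0) g h = L2_inner (magnetic_laplacian K g) h"
proof -
  let ?D = "magnetic_deriv K"
  note dg = sobolev_smooth_deriv[OF g] note dh = sobolev_smooth_deriv[OF h]
  have "L2_inner (?D b (?D b g)) h = - L2_inner (?D b g) (?D b h)" if b: "b \<in> Basis" for b
    by (intro magnetic_integration_by_parts sobolev_smoothD[OF dg] sobolev_smoothD[OF h] sobolev_smoothD[OF dh]
        sobolev_smoothD[OF sobolev_smooth_deriv[OF dg]] b)
  then have "sobolev_inner K (Suc 0) g h = (\<Sum>b\<in>Basis. (-1) * sobolev_inner K 0 (?D b (?D b g)) h)"
    by simp
  also have "\<dots> = sobolev_inner K 0 (\<lambda>z. (-1) * (\<Sum>b\<in>Basis. ?D b (?D b g) z)) h"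
    by (subst sobolev_inner_cmult_left, intro sobolev_smooth_sum sobolev_smooth_deriv g, assumption+,
        subst sobolev_inner_sum_left, intro sobolev_smooth_deriv g, assumption+, rule h)
      (simp only: sum_distrib_left)
  finally show ?thesis by (simp add: magnetic_laplacian_def[abs_def])
qed

text \<open>The constant \<open>c\<close> by which the commutators of \<open>L\<close> with magnetic derivatives are controlled; the factor
  two is that of \<open>magnetic_laplacian_deriv\<close>.\<close>
definition field_size :: "('a::euclidean_space \<Rightarrow> 'a) \<Rightarrow> real" where
  "field_size K = (\<Sum>b\<in>Basis. \<Sum>c\<in>Basis. 2 * \<bar>field_strength K c b\<bar>)"

lemma field_size_nonneg: "0 \<le> field_size K"
  by (simp add: field_size_def sum_nonneg)

text \<open>For \<open>m = 0\<close> this is integration by parts, without error. In the induction step \<open>L\<close> is commuted with one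
  more derivative; the resulting first order terms, estimated by the Cauchy-Schwarz inequality, add up to
  one further copy of \<open>field_size K\<close> times the product of the norms.\<close>
lemma sobolev_inner_laplacian:
  assumes "sobolev_smooth K g" "sobolev_smooth K h"
  shows "cmod (sobolev_inner K (Suc m) g h - sobolev_inner K m (magnetic_laplacian K g) h)
    \<le> field_size K * real m * (sobolev_norm K m g * sobolev_norm K m h)"
  using assms
proof (induction m arbitrary: g h)
  case 0
  then show ?case using sobolev_inner_energy[OF 0] by simp
next
  case (Suc m)
  let ?D = "magnetic_deriv K" and ?L = "magnetic_laplacian K"
  let ?S = "sobolev_norm K m" and ?S' = "sobolev_norm K (Suc m)" and ?Q = "sobolev_inner K m"
  note dg = sobolev_smooth_deriv[OF Suc.prems(1)] note dh = sobolev_smooth_deriv[OF Suc.prems(2)]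
  define E where "E b = sobolev_inner K (Suc m) (?D b g) (?D b h) - ?Q (?L (?D b g)) (?D b h)" for b
  define T where "T b c = - 2 * \<i> * of_real (field_strength K c b) * ?Q (?D c g) (?D b h)" for b c
  have commute: "?Q (?L (?D b g)) (?D b h) = ?Q (?D b (?L g)) (?D b h) + (\<Sum>c\<in>Basis. T b c)"
    if b: "b \<in> Basis" for b
  proof -
    define X where "X c = - 2 * \<i> * complex_of_real (field_strength K c b)" for c
    have X: "sobolev_smooth K (\<lambda>z. X c * ?D c g z)" if "c \<in> Basis" for c
      by (intro sobolev_smooth_cmult dg that)
    have "?Q (?L (?D b g)) (?D b h) = ?Q (\<lambda>z. ?D b (?L g) z + (\<Sum>c\<in>Basis. X c * ?D c g z)) (?D b h)"
      unfolding magnetic_laplacian_deriv[OF sobolev_smoothD(1)[OF Suc.prems(1)] b] X_def ..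
    also have "\<dots> = ?Q (?D b (?L g)) (?D b h) + ?Q (\<lambda>z. \<Sum>c\<in>Basis. X c * ?D c g z) (?D b h)"
      by (intro sobolev_inner_add_left sobolev_smooth_deriv sobolev_smooth_laplacian sobolev_smooth_sum
          X Suc.prems b)
    also have "?Q (\<lambda>z. \<Sum>c\<in>Basis. X c * ?D c g z) (?D b h) = (\<Sum>c\<in>Basis. ?Q (\<lambda>z. X c * ?D c g z) (?D b h))"
      by (intro sobolev_inner_sum_left X dh b)
    also have "\<dots> = (\<Sum>c\<in>Basis. T b c)"
      unfolding T_def X_def by (intro sum.cong refl sobolev_inner_cmult_left dg)
    finally show ?thesis .
  qed
  have eq: "sobolev_inner K (Suc (Suc m)) g h - sobolev_inner K (Suc m) (?L g) h
      = (\<Sum>b\<in>Basis. E b + (\<Sum>c\<in>Basis. T b c))"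
    unfolding sobolev_inner.simps(2)[of K "Suc m" g h] sobolev_inner.simps(2)[of K m "?L g" h] sum_subtractf[symmetric]
    by (intro sum.cong refl) (simp only: E_def commute, simp)
  have E_le: "cmod (E b) \<le> field_size K * real m * (\<bar>?S (?D b g)\<bar> * \<bar>?S (?D b h)\<bar>)" if "b \<in> Basis" for b
    using Suc.IH[OF dg[OF that] dh[OF that]] by (simp add: E_def sobolev_norm_nonneg)
  have T_le: "cmod (T b c) \<le> 2 * \<bar>field_strength K c b\<bar> * (?S' g * ?S' h)" if "b \<in> Basis" "c \<in> Basis" for b c
  proof -
    have "cmod (?Q (?D c g) (?D b h)) \<le> ?S (?D c g) * ?S (?D b h)"
      by (rule sobolev_cauchy_schwarz[OF dg dh]) fact+
    also have "\<dots> \<le> ?S' g * ?S' h"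
      by (intro mult_mono sobolev_norm_deriv_le sobolev_norm_nonneg that)
    finally have "2 * \<bar>field_strength K c b\<bar> * cmod (?Q (?D c g) (?D b h)) \<le> 2 * \<bar>field_strength K c b\<bar> * (?S' g * ?S' h)"
      by (intro mult_left_mono) auto
    then show ?thesis by (simp add: T_def norm_mult)
  qed
  have "cmod (\<Sum>b\<in>Basis. E b + (\<Sum>c\<in>Basis. T b c)) \<le> (\<Sum>b\<in>Basis. cmod (E b) + (\<Sum>c\<in>Basis. cmod (T b c)))"
    by (intro order_trans[OF norm_sum] sum_mono order_trans[OF norm_triangle_ineq] add_left_mono norm_sum)
  also have "\<dots> \<le> (\<Sum>b\<in>Basis. field_size K * real m * (\<bar>?S (?D b g)\<bar> * \<bar>?S (?D b h)\<bar>)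
      + (\<Sum>c\<in>Basis. 2 * \<bar>field_strength K c b\<bar> * (?S' g * ?S' h)))"
    by (intro sum_mono add_mono E_le T_le)
  also have "\<dots> = field_size K * real m * (\<Sum>b\<in>Basis. \<bar>?S (?D b g)\<bar> * \<bar>?S (?D b h)\<bar>)
      + field_size K * (?S' g * ?S' h)"
    by (simp only: sum.distrib sum_distrib_left[symmetric] sum_distrib_right[symmetric] field_size_def)
  also have "\<dots> \<le> field_size K * real m * (?S' g * ?S' h) + field_size K * (?S' g * ?S' h)"
    using field_size_nonneg[of K] unfolding sobolev_norm.simps
    by (intro add_right_mono mult_left_mono L2_set_mult_ineq) auto
  also have "\<dots> = field_size K * real (Suc m) * (?S' g * ?S' h)" by (simp add: algebra_simps)
  finally show ?case unfolding eq .
qed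

lemma sobolev_norm_one_step:
  assumes g: "sobolev_smooth K g"
  shows "(sobolev_norm K (Suc m) g)\<^sup>2 \<le> sobolev_norm K m g *
    (sobolev_norm K m (magnetic_laplacian K g) + field_size K * real m * sobolev_norm K m g)"
proof -
  let ?L = "magnetic_laplacian K g" and ?S = "sobolev_norm K m"
  have "(sobolev_norm K (Suc m) g)\<^sup>2 = cmod (sobolev_inner K (Suc m) g g)"
    by (simp only: sobolev_inner_self[OF sobolev_smoothD(1)[OF g]] norm_of_real) simp
  also have "\<dots> \<le> cmod (sobolev_inner K m ?L g) + cmod (sobolev_inner K (Suc m) g g - sobolev_inner K m ?L g)"
    by (rule norm_triangle_sub)
  also have "\<dots> \<le> ?S ?L * ?S g + field_size K * real m * (?S g * ?S g)"
    by (intro add_mono sobolev_cauchy_schwarz sobolev_inner_laplacian sobolev_smooth_laplacian g)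
  finally show ?thesis by (simp add: algebra_simps)
qed

text \<open>Move one Laplacian onto each argument of the form of order \<open>m + 2\<close>. Both moves leave commutator errors, and
  the choice of constants is such that the bound completes a square.\<close>
lemma sobolev_norm_two_steps:
  assumes g: "sobolev_smooth K g"
  shows "sobolev_norm K (Suc (Suc m)) g \<le>
    sobolev_norm K m (magnetic_laplacian K g) + field_size K * real (Suc m) * sobolev_norm K m g"
proof -
  let ?L = "magnetic_laplacian K g" and ?S = "sobolev_norm K m" and ?S1 = "sobolev_norm K (Suc m)"
  define c where "c = field_size K"
  have c: "0 \<le> c" by (simp add: c_def field_size_nonneg)
  note L = sobolev_smooth_laplacian[OF g]
  define A where "A = sobolev_inner K (Suc (Suc m)) g g - sobolev_inner K (Suc m) ?L g"
  define B where "B = sobolev_inner K (Suc m) g ?L - sobolev_inner K m ?L ?L"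
  have A: "cmod A \<le> c * real (Suc m) * (?S1 g * ?S1 g)"
    unfolding A_def c_def by (rule sobolev_inner_laplacian[OF g g])
  have B: "cmod B \<le> c * real m * (?S g * ?S ?L)"
    unfolding B_def c_def by (rule sobolev_inner_laplacian[OF g L])
  have "sobolev_inner K (Suc (Suc m)) g g = A + cnj B + cnj (sobolev_inner K m ?L ?L)"
    unfolding A_def B_def using sobolev_inner_cnj[of K "Suc m" ?L g] by simp
  then have "of_real ((sobolev_norm K (Suc (Suc m)) g)\<^sup>2) = A + cnj B + of_real ((?S ?L)\<^sup>2)"
    by (simp only: sobolev_inner_self[OF sobolev_smoothD(1)[OF g]] sobolev_inner_self[OF sobolev_smoothD(1)[OF L]]
        complex_cnj_complex_of_real)
  then have "(sobolev_norm K (Suc (Suc m)) g)\<^sup>2 = cmod (A + cnj B + of_real ((?S ?L)\<^sup>2))"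
    by (metis norm_of_real abs_of_nonneg zero_le_power2)
  also have "\<dots> \<le> cmod A + cmod B + (?S ?L)\<^sup>2"
    by (intro order_trans[OF norm_triangle_ineq] add_mono) (auto intro: order_trans[OF norm_triangle_ineq] simp: norm_power)
  also have "\<dots> \<le> c * real (Suc m) * (?S1 g)\<^sup>2 + c * real m * (?S g * ?S ?L) + (?S ?L)\<^sup>2"
    using A B by (simp add: power2_eq_square)
  also have "\<dots> \<le> c * real (Suc m) * (?S g * (?S ?L + c * real m * ?S g)) + c * real m * (?S g * ?S ?L) + (?S ?L)\<^sup>2"
    using sobolev_norm_one_step[OF g, of m] c by (intro add_right_mono mult_left_mono) (auto simp: c_def)
  also have "\<dots> \<le> (?S ?L + c * real (Suc m) * ?S g)\<^sup>2"
  proof -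
    have "0 \<le> c * (?S g * ?S ?L)" "0 \<le> (c * ?S g)\<^sup>2 * (real m + 1)"
      using c sobolev_norm_nonneg by (auto intro!: mult_nonneg_nonneg)
    then show ?thesis by (simp add: power2_eq_square algebra_simps)
  qed
  finally show ?thesis unfolding c_def
    by (rule power2_le_imp_le) (use field_size_nonneg sobolev_norm_nonneg in \<open>auto intro!: add_nonneg_nonneg mult_nonneg_nonneg\<close>)
qed

lemma sobolev_norm_word:
  "set vs \<subseteq> Basis \<Longrightarrow>
    sobolev_norm K m (foldr (magnetic_deriv K) vs g) \<le> sobolev_norm K (m + length vs) g"
proof (induction vs arbitrary: m)
  case (Cons b vs)
  have "sobolev_norm K m (foldr (magnetic_deriv K) (b # vs) g) \<le> sobolev_norm K (Suc m) (foldr (magnetic_deriv K) vs g)"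
    using Cons.prems by (simp del: sobolev_norm.simps add: sobolev_norm_deriv_le)
  also have "\<dots> \<le> sobolev_norm K (m + length (b # vs)) g" using Cons.IH[of "Suc m"] Cons.prems by simp
  finally show ?case .
qed simp

section \<open>Pointwise bounds\<close>

text \<open>Integration over the affine space through \<open>z\<close> spanned by a list of directions, one direction at a time;
  for an enumeration of \<open>Basis\<close> this is the full integral and \<open>z\<close> disappears.\<close>
primrec line_integrals :: "'a::euclidean_space list \<Rightarrow> ('a \<Rightarrow> ennreal) \<Rightarrow> 'a \<Rightarrow> ennreal" where
  "line_integrals [] u z = u z"
| "line_integrals (b # bs) u z = (\<integral>\<^sup>+t. line_integrals bs u (z + t *\<^sub>R b) \<partial>lborel)"

lemma line_integrals_measurable [measurable]:
  assumes [measurable]: "u \<in> borel_measurable borel"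
  shows "line_integrals bs u \<in> borel_measurable borel"
proof (induction bs)
  case Nil
  have "line_integrals [] u = u" by (simp add: fun_eq_iff)
  then show ?case by simp
next
  case (Cons b bs)
  note [measurable] = Cons.IH
  have "line_integrals (b # bs) u = (\<lambda>z. \<integral>\<^sup>+t. line_integrals bs u (z + t *\<^sub>R b) \<partial>lborel)"
    by (simp add: fun_eq_iff)
  also have "\<dots> \<in> borel_measurable borel" by measurable
  finally show ?case .
qed

lemma line_integrals_add:
  assumes u [measurable]: "u \<in> borel_measurable borel" and v [measurable]: "v \<in> borel_measurable borel"
  shows "line_integrals bs (\<lambda>z. u z + v z) z = line_integrals bs u z + line_integrals bs v z"
  by (induction bs arbitrary: z) (simp_all add: nn_integral_add)

lemma line_integrals_cmult:
  assumes u [measurable]: "u \<in> borel_measurable borel"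
  shows "line_integrals bs (\<lambda>z. c * u z) z = c * line_integrals bs u z"
  by (induction bs arbitrary: z) (simp_all add: nn_integral_cmult)

lemma line_integrals_eq_PiM:
  assumes u [measurable]: "u \<in> borel_measurable borel" and "distinct bs"
  shows "line_integrals bs u z = (\<integral>\<^sup>+x. u (z + (\<Sum>b\<in>set bs. x b *\<^sub>R b)) \<partial>(\<Pi>\<^sub>M b\<in>set bs. lborel))"
  using assms(2)
proof (induction bs arbitrary: z)
  interpret product_sigma_finite "\<lambda>_. lborel :: real measure" ..
  case Nil
  show ?case
    by (simp only: list.set(1) sum.empty add_0_right line_integrals.simps nn_integral_empty[OF zero_le])
next
  interpret product_sigma_finite "\<lambda>_. lborel :: real measure" ..
  case (Cons b bs)
  have b: "b \<notin> set bs" using Cons.prems by simp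
  have IH: "line_integrals bs u y = (\<integral>\<^sup>+x. u (y + (\<Sum>c\<in>set bs. x c *\<^sub>R c)) \<partial>(\<Pi>\<^sub>M c\<in>set bs. lborel))" for y
    using Cons by simp
  have upd: "(\<Sum>c\<in>insert b (set bs). (x(b := t)) c *\<^sub>R c) = t *\<^sub>R b + (\<Sum>c\<in>set bs. x c *\<^sub>R c)" for x t
  proof -
    have "(\<Sum>c\<in>set bs. (x(b := t)) c *\<^sub>R c) = (\<Sum>c\<in>set bs. x c *\<^sub>R c)"
      using b by (intro sum.cong) auto
    then show ?thesis using b by simp
  qed
  have meas [measurable]:
    "(\<lambda>x. \<Sum>c\<in>insert b (set bs). x c *\<^sub>R c) \<in> borel_measurable (\<Pi>\<^sub>M c\<in>insert b (set bs). lborel)"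
    by (intro borel_measurable_sum borel_measurable_scaleR borel_measurable_const
        measurable_component_singleton[THEN measurable_compose, OF _ measurable_ident_sets]) auto
  have "(\<integral>\<^sup>+x. u (z + (\<Sum>c\<in>insert b (set bs). x c *\<^sub>R c)) \<partial>(\<Pi>\<^sub>M c\<in>insert b (set bs). lborel))
      = (\<integral>\<^sup>+t. \<integral>\<^sup>+x. u (z + (\<Sum>c\<in>insert b (set bs). (x(b := t)) c *\<^sub>R c)) \<partial>(\<Pi>\<^sub>M c\<in>set bs. lborel) \<partial>lborel)"
    by (rule product_nn_integral_insert_rev) (use b in \<open>auto intro: measurable_compose[OF borel_measurable_add[OF borel_measurable_const meas] u]\<close>)
  also have "\<dots> = (\<integral>\<^sup>+t. line_integrals bs u (z + t *\<^sub>R b) \<partial>lborel)"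
    by (simp only: upd IH add.assoc)
  finally show ?case by (simp only: line_integrals.simps list.set(2))
qed

lemma line_integrals_Basis:
  fixes u :: "'a::euclidean_space \<Rightarrow> ennreal"
  assumes u [measurable]: "u \<in> borel_measurable borel" and "distinct bs" "set bs = Basis"
  shows "line_integrals bs u z = (\<integral>\<^sup>+y. u y \<partial>lborel)"
proof -
  have meas: "(\<lambda>x. \<Sum>b\<in>Basis. x b *\<^sub>R b) \<in> (\<Pi>\<^sub>M b\<in>(Basis :: 'a set). lborel) \<rightarrow>\<^sub>M borel"
    by (intro borel_measurable_sum borel_measurable_scaleR measurable_component_singleton[THEN measurable_compose]) auto
  have "line_integrals bs u z = (\<integral>\<^sup>+x. u (z + (\<Sum>b\<in>Basis. x b *\<^sub>R b)) \<partial>(\<Pi>\<^sub>M b\<in>Basis. lborel))"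
    using line_integrals_eq_PiM[OF assms(1,2)] assms(3) by simp
  also have "\<dots> = (\<integral>\<^sup>+y. u (z + y) \<partial>distr (\<Pi>\<^sub>M b\<in>Basis. lborel) borel (\<lambda>x. \<Sum>b\<in>Basis. x b *\<^sub>R b))"
    by (rule nn_integral_distr[symmetric, OF meas]) measurable
  also have "\<dots> = (\<integral>\<^sup>+y. u (z + y) \<partial>lborel)" by (simp only: lborel_eq[symmetric])
  also have "\<dots> = (\<integral>\<^sup>+y. u y \<partial>distr lborel borel ((+) z))"
    by (rule nn_integral_distr[symmetric]) measurable
  finally show ?thesis by (simp only: lborel_distr_plus)
qed

text \<open>The one-dimensional Sobolev inequality for \<open>u(t) = |g(z + t b)|\<^sup>2\<close>, whose derivative is bounded by
  \<open>|g|\<^sup>2 + |D\<^sub>b g|\<^sup>2\<close>.\<close>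
lemma line_sobolev:
  assumes g: "smooth g" and b: "b \<in> Basis"
  shows "ennreal ((cmod (g z))\<^sup>2)
    \<le> (\<integral>\<^sup>+t. ennreal (2 * ((cmod (g (z + t *\<^sub>R b)))\<^sup>2 + (cmod (magnetic_deriv K b g (z + t *\<^sub>R b)))\<^sup>2)) \<partial>lborel)"
proof -
  let ?D = "magnetic_deriv K b g"
  define u where "u t = Re (g (z + t *\<^sub>R b) * cnj (g (z + t *\<^sub>R b)))" for t
  define u' where "u' t = Re (?D (z + t *\<^sub>R b) * cnj (g (z + t *\<^sub>R b)) + g (z + t *\<^sub>R b) * cnj (?D (z + t *\<^sub>R b)))" for t
  define v where "v t = 2 * ((cmod (g (z + t *\<^sub>R b)))\<^sup>2 + (cmod (?D (z + t *\<^sub>R b)))\<^sup>2)" for t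
  have v_nonneg: "0 \<le> v t" for t by (simp add: v_def)
  have u_eq: "u t = (cmod (g (z + t *\<^sub>R b)))\<^sup>2" for t
    unfolding u_def complex_norm_square[symmetric] by simp
  have cont: "continuous_on A (\<lambda>t. g (z + t *\<^sub>R b))" "continuous_on A (\<lambda>t. ?D (z + t *\<^sub>R b))" for A
    by (rule continuous_on_compose2[OF smooth_imp_continuous[OF g]]
        continuous_on_compose2[OF smooth_imp_continuous[OF smooth_magnetic_deriv[OF g b]]];
        auto intro!: continuous_intros)+
  have contu: "continuous_on A u" "continuous_on A u'" "continuous_on A v" for A
    unfolding u_def[abs_def] u'_def[abs_def] v_def[abs_def] using cont by (intro continuous_intros; simp)+
  have der: "(u has_vector_derivative u' t) (at t)" for t
    unfolding u_def[abs_def] u'_def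
    by (rule bounded_linear.has_vector_derivative[OF bounded_linear_Re magnetic_product_has_derivative[OF g g b]])
  \<comment> \<open>The weight \<open>t - 1\<close> vanishes at \<open>1\<close>, so that integrating over \<open>[0,1]\<close> isolates \<open>u(0)\<close>.\<close>
  have der2: "((\<lambda>t. (t - 1) * u t) has_vector_derivative (t - 1) * u' t + 1 * u t) (at t)" for t
    by (rule has_vector_derivative_mult[OF _ der]) (auto intro!: derivative_eq_intros)
  have "(LINT t|lborel. indicator {0..1::real} t *\<^sub>R ((t - 1) * u' t + 1 * u t)) = (1 - 1) * u 1 - (0 - 1) * u 0"
    by (rule integral_FTC_Icc) (auto intro!: has_vector_derivative_at_within[OF der2[simplified]] contu continuous_intros)
  then have "u 0 = (LINT t|lborel. indicator {0..1::real} t *\<^sub>R ((t - 1) * u' t + 1 * u t))" by simp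
  also have "\<dots> \<le> (LINT t|lborel. indicator {0..1::real} t *\<^sub>R v t)"
  proof (rule integral_mono)
    show "integrable lborel (\<lambda>t. indicator {0..1::real} t *\<^sub>R ((t - 1) * u' t + 1 * u t))"
      by (intro borel_integrable_compact continuous_intros contu) auto
    show "integrable lborel (\<lambda>t. indicator {0..1::real} t *\<^sub>R v t)"
      by (intro borel_integrable_compact contu) auto
    fix t :: real
    show "indicator {0..1::real} t *\<^sub>R ((t - 1) * u' t + 1 * u t) \<le> indicator {0..1::real} t *\<^sub>R v t"
    proof (cases "t \<in> {0..1}")
      case True
      let ?a = "cmod (g (z + t *\<^sub>R b))" and ?d = "cmod (?D (z + t *\<^sub>R b))"
      have "\<bar>u' t\<bar> \<le> ?d * ?a + ?a * ?d"
        unfolding u'_def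
        by (rule order_trans[OF abs_Re_le_cmod]) (auto intro: order_trans[OF norm_triangle_ineq] simp: norm_mult)
      also have "\<dots> \<le> ?a\<^sup>2 + ?d\<^sup>2" using sum_squares_bound[of ?a ?d] by simp
      finally have u'_le: "\<bar>u' t\<bar> \<le> ?a\<^sup>2 + ?d\<^sup>2" .
      have "(t - 1) * u' t \<le> \<bar>t - 1\<bar> * \<bar>u' t\<bar>" by (metis abs_ge_self abs_mult)
      also have "\<dots> \<le> 1 * (?a\<^sup>2 + ?d\<^sup>2)" using True u'_le by (intro mult_mono) auto
      finally have "(t - 1) * u' t \<le> ?a\<^sup>2 + ?d\<^sup>2" by simp
      moreover have "0 \<le> ?d\<^sup>2" by simp
      moreover have "x + 1 * c \<le> 2 * (c + d)" if "x \<le> c + d" "0 \<le> d" for x c d :: real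
        using that by simp
      ultimately have "(t - 1) * u' t + 1 * u t \<le> v t" unfolding v_def u_eq by blast
      then show ?thesis using True by simp
    qed simp
  qed
  finally have "ennreal (u 0) \<le> ennreal (LINT t|lborel. indicator {0..1::real} t *\<^sub>R v t)" by (rule ennreal_leI)
  also have "\<dots> = (\<integral>\<^sup>+t. ennreal (indicator {0..1::real} t *\<^sub>R v t) \<partial>lborel)"
  proof (rule nn_integral_eq_integral[symmetric])
    show "integrable lborel (\<lambda>t. indicator {0..1::real} t *\<^sub>R v t)"
      by (intro borel_integrable_compact contu) auto
  qed (simp add: v_nonneg)
  also have "\<dots> \<le> (\<integral>\<^sup>+t. ennreal (v t) \<partial>lborel)"
    using v_nonneg by (intro nn_integral_mono ennreal_leI) (simp add: indicator_def)
  finally show ?thesis by (simp add: u_eq v_def)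
qed

text \<open>Iterating \<open>line_sobolev\<close> over a list of directions produces each product of distinct directions from the
  list once, up to constant factors; for an enumeration of \<open>Basis\<close> their order is at most the dimension.\<close>
primrec mixed_energy ::
    "('a::euclidean_space \<Rightarrow> 'a) \<Rightarrow> 'a list \<Rightarrow> ('a \<Rightarrow> complex) \<Rightarrow> 'a \<Rightarrow> ennreal" where
  "mixed_energy K [] g z = ennreal ((cmod (g z))\<^sup>2)"
| "mixed_energy K (b # bs) g z = 2 * (mixed_energy K bs g z + mixed_energy K bs (magnetic_deriv K b g) z)"

lemma mixed_energy_measurable:
  "smooth g \<Longrightarrow> set bs \<subseteq> Basis \<Longrightarrow> mixed_energy K bs g \<in> borel_measurable borel"
proof (induction bs arbitrary: g)
  case Nil
  note [measurable] = smooth_measurable[OF Nil(1)]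
  have "mixed_energy K [] g = (\<lambda>z. ennreal ((cmod (g z))\<^sup>2))" by (simp add: fun_eq_iff)
  then show ?case by simp
next
  case (Cons b bs)
  have [measurable]: "mixed_energy K bs g \<in> borel_measurable borel"
      "mixed_energy K bs (magnetic_deriv K b g) \<in> borel_measurable borel"
    using Cons by (auto intro: smooth_magnetic_deriv)
  have "mixed_energy K (b # bs) g = (\<lambda>z. 2 * (mixed_energy K bs g z + mixed_energy K bs (magnetic_deriv K b g) z))"
    by (simp add: fun_eq_iff)
  then show ?case by simp
qed

lemma pointwise_le_line_integrals:
  "smooth g \<Longrightarrow> set bs \<subseteq> Basis \<Longrightarrow>
    ennreal ((cmod (g z))\<^sup>2) \<le> line_integrals bs (mixed_energy K bs g) z"
proof (induction bs arbitrary: g z)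
  case (Cons b bs)
  let ?D = "magnetic_deriv K b g"
  have b: "b \<in> Basis" "set bs \<subseteq> Basis" using Cons.prems by auto
  note sm = Cons.prems(1) smooth_magnetic_deriv[OF Cons.prems(1) b(1), of K]
  have meas: "mixed_energy K bs g \<in> borel_measurable borel" "mixed_energy K bs ?D \<in> borel_measurable borel"
    using sm b by (auto intro: mixed_energy_measurable)
  note [measurable] = meas
  have eq: "line_integrals bs (mixed_energy K (b # bs) g) y
      = 2 * (line_integrals bs (mixed_energy K bs g) y + line_integrals bs (mixed_energy K bs ?D) y)" for y
  proof -
    have "mixed_energy K (b # bs) g = (\<lambda>z. 2 * (mixed_energy K bs g z + mixed_energy K bs ?D z))"
      by (simp add: fun_eq_iff)
    then show ?thesis by (simp only:) (subst line_integrals_cmult, measurable, simp add: line_integrals_add meas)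
  qed
  have "ennreal ((cmod (g z))\<^sup>2)
      \<le> (\<integral>\<^sup>+t. ennreal (2 * ((cmod (g (z + t *\<^sub>R b)))\<^sup>2 + (cmod (?D (z + t *\<^sub>R b)))\<^sup>2)) \<partial>lborel)"
    by (rule line_sobolev[OF sm(1) b(1)])
  also have "\<dots> \<le> (\<integral>\<^sup>+t. line_integrals bs (mixed_energy K (b # bs) g) (z + t *\<^sub>R b) \<partial>lborel)"
  proof (rule nn_integral_mono)
    fix t
    let ?y = "z + t *\<^sub>R b"
    have "ennreal (2 * ((cmod (g ?y))\<^sup>2 + (cmod (?D ?y))\<^sup>2)) = 2 * (ennreal ((cmod (g ?y))\<^sup>2) + ennreal ((cmod (?D ?y))\<^sup>2))"
      by (simp add: ennreal_mult')
    also have "\<dots> \<le> 2 * (line_integrals bs (mixed_energy K bs g) ?y + line_integrals bs (mixed_energy K bs ?D) ?y)"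
      by (intro mult_left_mono add_mono Cons.IH sm b) simp
    finally show "ennreal (2 * ((cmod (g ?y))\<^sup>2 + (cmod (?D ?y))\<^sup>2)) \<le> line_integrals bs (mixed_energy K (b # bs) g) ?y"
      unfolding eq .
  qed
  finally show ?case by (simp only: line_integrals.simps)
qed simp

lemma integral_mixed_energy_le:
  assumes "sobolev_smooth K g" "set bs \<subseteq> Basis" "\<And>i. i \<le> length bs \<Longrightarrow> sobolev_norm K i g \<le> X"
  shows "(\<integral>\<^sup>+z. mixed_energy K bs g z \<partial>lborel) \<le> ennreal (4 ^ length bs * X\<^sup>2)"
  using assms
proof (induction bs arbitrary: g)
  case Nil
  have "(\<integral>\<^sup>+z. ennreal ((cmod (g z))\<^sup>2) \<partial>lborel) = ennreal ((L2_norm g)\<^sup>2)"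
    unfolding L2_norm_smooth[OF sobolev_smoothD(1)[OF Nil(1)]]
    using sobolev_smoothD[OF Nil(1)] by (intro nn_integral_eq_integral) (auto simp: in_L2_smooth)
  also have "\<dots> \<le> ennreal (X\<^sup>2)"
    using Nil(3)[of 0] by (intro ennreal_leI power_mono) (auto simp: L2_norm_nonneg)
  finally show ?case by simp
next
  case (Cons b bs)
  let ?D = "magnetic_deriv K b g"
  have b: "b \<in> Basis" "set bs \<subseteq> Basis" using Cons.prems by auto
  note D = sobolev_smooth_deriv[OF Cons.prems(1) b(1)]
  have [measurable]: "mixed_energy K bs g \<in> borel_measurable borel" "mixed_energy K bs ?D \<in> borel_measurable borel"
    by (intro mixed_energy_measurable sobolev_smoothD(1)[OF D] sobolev_smoothD(1)[OF Cons.prems(1)] b)+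
  have "sobolev_norm K i ?D \<le> X" if "i \<le> length bs" for i
    using sobolev_norm_deriv_le[OF b(1), of K i g] Cons.prems(3)[of "Suc i"] that
    by (simp del: sobolev_norm.simps)
  then have D_le: "(\<integral>\<^sup>+z. mixed_energy K bs ?D z \<partial>lborel) \<le> ennreal (4 ^ length bs * X\<^sup>2)"
    by (intro Cons.IH D b)
  have g_le: "(\<integral>\<^sup>+z. mixed_energy K bs g z \<partial>lborel) \<le> ennreal (4 ^ length bs * X\<^sup>2)"
    using Cons.prems by (intro Cons.IH) auto
  have "(\<integral>\<^sup>+z. mixed_energy K (b # bs) g z \<partial>lborel)
      = 2 * ((\<integral>\<^sup>+z. mixed_energy K bs g z \<partial>lborel) + (\<integral>\<^sup>+z. mixed_energy K bs ?D z \<partial>lborel))"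
    by (simp add: nn_integral_cmult nn_integral_add)
  also have "\<dots> \<le> 2 * (ennreal (4 ^ length bs * X\<^sup>2) + ennreal (4 ^ length bs * X\<^sup>2))"
    by (intro mult_left_mono add_mono D_le g_le) simp
  also have "\<dots> = ennreal (2 * (4 ^ length bs * X\<^sup>2 + 4 ^ length bs * X\<^sup>2))"
  proof -
    have "2 * (ennreal Y + ennreal Y) = ennreal (2 * (Y + Y))" if "0 \<le> Y" for Y
      using that by (simp only: ennreal_mult[of 2 "Y + Y"] ennreal_plus ennreal_numeral add_nonneg_nonneg zero_le_numeral)
    then show ?thesis by simp
  qed
  also have "2 * (4 ^ length bs * X\<^sup>2 + 4 ^ length bs * X\<^sup>2) = 4 ^ length (b # bs) * X\<^sup>2" by simp
  finally show ?case .
qed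

lemma magnetic_sobolev_embedding:
  fixes g :: "'a::euclidean_space \<Rightarrow> complex"
  assumes g: "sobolev_smooth K g" and X: "\<And>i. i \<le> DIM('a) \<Longrightarrow> sobolev_norm K i g \<le> X"
  shows "cmod (g z) \<le> 2 ^ DIM('a) * X"
proof -
  obtain bs :: "'a list" where bs: "set bs = Basis" "distinct bs"
    using finite_distinct_list[OF finite_Basis] by blast
  have len: "length bs = DIM('a)" using distinct_card[OF bs(2)] bs(1) by simp
  have X0: "0 \<le> X" using order_trans[OF sobolev_norm_nonneg X[of 0]] by simp
  have "ennreal ((cmod (g z))\<^sup>2) \<le> line_integrals bs (mixed_energy K bs g) z"
    by (intro pointwise_le_line_integrals sobolev_smoothD(1)[OF g]) (simp add: bs)
  also have "\<dots> = (\<integral>\<^sup>+y. mixed_energy K bs g y \<partial>lborel)"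
    by (intro line_integrals_Basis mixed_energy_measurable sobolev_smoothD(1)[OF g] bs) (simp add: bs)
  also have "\<dots> \<le> ennreal (4 ^ length bs * X\<^sup>2)"
    by (intro integral_mixed_energy_le g) (auto simp: bs len X)
  finally have "(cmod (g z))\<^sup>2 \<le> 4 ^ DIM('a) * X\<^sup>2" by (simp add: len)
  also have "(4::real) ^ DIM('a) = (2 ^ DIM('a))\<^sup>2"
    by (simp add: power2_eq_square flip: power_mult_distrib)
  also have "(2 ^ DIM('a))\<^sup>2 * X\<^sup>2 = (2 ^ DIM('a) * X)\<^sup>2" by (rule power_mult_distrib[symmetric])
  finally show ?thesis by (rule power2_le_imp_le) (simp add: X0)
qed

section \<open>Propagation of flatness\<close>

lemma iterated_partial_snoc: "iterated_partial (vs @ [v]) f = iterated_partial vs (partial_deriv v f)"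
  by (simp add: iterated_partial_def)

lemma iterated_partial_add:
  "smooth f \<Longrightarrow> smooth g \<Longrightarrow> set vs \<subseteq> Basis \<Longrightarrow>
    iterated_partial vs (\<lambda>z. f z + g z) z = iterated_partial vs f z + iterated_partial vs g z"
proof (induction vs arbitrary: f g rule: rev_induct)
  case Nil
  then show ?case by (simp add: iterated_partial_def)
next
  case (snoc v vs)
  then show ?case by (simp add: iterated_partial_snoc partial_deriv_add smooth_partial)
qed

lemma iterated_partial_cmult:
  fixes f :: "'a::euclidean_space \<Rightarrow> complex"
  shows "smooth f \<Longrightarrow> set vs \<subseteq> Basis \<Longrightarrow>
    iterated_partial vs (\<lambda>z. c * f z) z = c * iterated_partial vs f z"
proof (induction vs arbitrary: f rule: rev_induct)
  case Nil
  then show ?case by (simp add: iterated_partial_def)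
next
  case (snoc v vs)
  then show ?case by (simp add: iterated_partial_snoc partial_deriv_cmult smooth_partial)
qed

definition flat_at :: "'a::euclidean_space \<Rightarrow> ('a \<Rightarrow> complex) \<Rightarrow> bool" where
  "flat_at w f \<longleftrightarrow> smooth f \<and> (\<forall>vs. set vs \<subseteq> Basis \<longrightarrow> iterated_partial vs f w = 0)"

lemma flat_at_imp_zero: "flat_at w f \<Longrightarrow> f w = 0"
  unfolding flat_at_def iterated_partial_def by (metis empty_subsetI foldr.simps(1) id_apply list.set(1))

lemma flat_at_partial: "flat_at w f \<Longrightarrow> v \<in> Basis \<Longrightarrow> flat_at w (partial_deriv v f)"
  unfolding flat_at_def iterated_partial_snoc[symmetric] by (auto intro: smooth_partial)

lemma flat_at_linear_mult:
  assumes "flat_at w f"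
  shows "flat_at w (\<lambda>z. of_real (z \<bullet> k) * f z)"
proof -
  have "iterated_partial vs (\<lambda>z. of_real (z \<bullet> k) * f z) w = 0" if "set vs \<subseteq> Basis" "flat_at w f" for vs f
    using that
  proof (induction vs arbitrary: f rule: rev_induct)
    case Nil
    then show ?case by (simp add: iterated_partial_def flat_at_imp_zero)
  next
    case (snoc v vs)
    have v: "v \<in> Basis" "set vs \<subseteq> Basis" using snoc.prems by auto
    have f: "smooth f" using snoc.prems by (simp add: flat_at_def)
    have "iterated_partial (vs @ [v]) (\<lambda>z. of_real (z \<bullet> k) * f z) w
        = iterated_partial vs (\<lambda>z. of_real (z \<bullet> k) * partial_deriv v f z) w
          + of_real (v \<bullet> k) * iterated_partial vs f w"
      unfolding iterated_partial_snoc partial_deriv_linear_mult[OF f v(1)]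
      by (subst iterated_partial_add)
        (simp_all add: v f smooth_linear_mult smooth_cmult smooth_partial iterated_partial_cmult)
    also have "\<dots> = 0"
      using snoc.IH[OF v(2) flat_at_partial[OF snoc.prems(2) v(1)]] snoc.prems(2) v by (simp add: flat_at_def)
    finally show ?case .
  qed
  then show ?thesis using assms by (simp add: flat_at_def smooth_linear_mult)
qed

lemma flat_at_magnetic_deriv:
  assumes "flat_at w f" "b \<in> Basis"
  shows "flat_at w (magnetic_deriv K b f)"
proof -
  have "flat_at w (\<lambda>z. \<i> * (of_real (z \<bullet> K b) * f z))"
    using flat_at_linear_mult[OF assms(1)] by (simp add: flat_at_def smooth_cmult iterated_partial_cmult)
  then show ?thesis
    using flat_at_partial[OF assms]
    by (simp add: flat_at_def magnetic_deriv_def[abs_def] smooth_add iterated_partial_add)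
qed

text \<open>Flatness can be expressed by magnetic instead of ordinary derivatives, since flat functions are stable
  under multiplication by the linear potential.\<close>
lemma flat_at_imp_magnetic_flat:
  assumes "flat_at w f" "set vs \<subseteq> Basis"
  shows "foldr (magnetic_deriv K) vs f w = 0"
proof -
  have "flat_at w (foldr (magnetic_deriv K) vs f)"
    using assms(2) by (induction vs) (auto intro: flat_at_magnetic_deriv assms(1))
  then show ?thesis by (rule flat_at_imp_zero)
qed

lemma magnetic_laplacian_symmetric:
  assumes g: "sobolev_smooth K g" and h: "sobolev_smooth K h"
  shows "L2_inner (magnetic_laplacian K g) h = L2_inner g (magnetic_laplacian K h)"
proof -
  have "L2_inner (magnetic_laplacian K g) h = sobolev_inner K (Suc 0) g h"
    by (rule sobolev_inner_energy[OF g h, symmetric])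
  also have "\<dots> = cnj (sobolev_inner K (Suc 0) h g)" by (rule sobolev_inner_cnj)
  also have "\<dots> = cnj (L2_inner (magnetic_laplacian K h) g)" by (simp only: sobolev_inner_energy[OF h g])
  also have "\<dots> = L2_inner g (magnetic_laplacian K h)" by (rule L2_inner_cnj[symmetric])
  finally show ?thesis .
qed

lemma magnetic_powers_log_convex:
  assumes g: "sobolev_smooth K g"
  defines "L \<equiv> magnetic_laplacian K"
  shows "(L2_norm (L g))\<^sup>2 \<le> L2_norm g * L2_norm (L (L g))"
proof -
  have Lg: "sobolev_smooth K (L g)" "sobolev_smooth K (L (L g))"
    unfolding L_def by (intro sobolev_smooth_laplacian g)+
  have "(L2_norm (L g))\<^sup>2 = cmod (L2_inner (L g) (L g))"
    by (simp add: L2_inner_self[OF sobolev_smoothD(1)[OF Lg(1)]] norm_power L2_norm_nonneg)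
  also have "L2_inner (L g) (L g) = L2_inner g (L (L g))"
    using magnetic_laplacian_symmetric[OF g Lg(1)] by (simp add: L_def)
  also have "cmod (L2_inner g (L (L g))) \<le> L2_norm g * L2_norm (L (L g))"
    by (intro L2_cauchy_schwarz sobolev_smoothD[OF g] sobolev_smoothD[OF Lg(2)])
  finally show ?thesis .
qed

text \<open>The sequence \<open>a\<close> consists of the numbers \<open>sqrt (r\<^sub>i + c (2i + 1) + 1)\<close>, each taken twice. The
  summand \<open>1\<close> makes products of the \<open>a\<^sub>i\<close> increase with their length, which later absorbs the extra
  derivatives of the Sobolev inequality.\<close>
lemma sobolev_norm_growth:
  assumes f: "sobolev_smooth K f"
    and diverge: "(\<Sum>m. inverse (ennreal (L2_norm ((magnetic_laplacian K ^^ Suc m) f) powr (1 / (2 * real (Suc m)))))) = \<infinity>"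
  obtains C a where "0 \<le> C" "\<And>i. 1 \<le> a i" "incseq a" "\<not> summable (\<lambda>i. 1 / a i)"
    "\<And>m. sobolev_norm K m f \<le> C * (\<Prod>i<Suc m. a i)"
proof -
  let ?L = "magnetic_laplacian K"
  have Lf: "sobolev_smooth K ((?L ^^ k) f)" for k
    by (induction k) (auto intro: sobolev_smooth_laplacian f)
  have convex: "(L2_norm ((?L ^^ Suc k) f))\<^sup>2 \<le> L2_norm ((?L ^^ k) f) * L2_norm ((?L ^^ Suc (Suc k)) f)" for k
    using magnetic_powers_log_convex[OF Lf[of k]] by simp
  obtain r C where r: "0 \<le> C" "\<And>i. 0 < r i" "incseq r"
      "\<And>j. L2_norm ((?L ^^ j) f) \<le> C * (\<Prod>i<j. r i)" "\<not> summable (\<lambda>i. 1 / sqrt (r i))"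
    by (rule carleman_ratios[of "\<lambda>k. L2_norm ((?L ^^ k) f)", OF L2_norm_nonneg convex diverge])
      (rule that; assumption)
  define c where "c = field_size K"
  have c: "0 \<le> c" by (simp add: c_def field_size_nonneg)
  define rho where "rho i = r i + c * (2 * real i + 1) + 1" for i
  have rho_ge: "1 \<le> rho i" for i
    unfolding rho_def using r(2)[of i] c by (simp add: less_imp_le)
  have rho_mono: "rho i \<le> rho j" if "i \<le> j" for i j
    unfolding rho_def using that c incseqD[OF r(3) that] by (intro add_mono mult_left_mono) auto
  define a where "a i = sqrt (rho (i div 2))" for i
  show ?thesis
  proof (rule that[of C a])
    show "1 \<le> a i" for i using rho_ge by (simp add: a_def)
    show "incseq a" by (auto simp: a_def incseq_def intro!: rho_mono div_le_mono)
    show "\<not> summable (\<lambda>i. 1 / a i)"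
    proof
      assume "summable (\<lambda>i. 1 / a i)"
      then have "summable ((\<lambda>i. 1 / a i) \<circ> (\<lambda>i. 2 * i))"
        by (rule summable_reindex) (auto simp: inj_on_def a_def intro: order_trans[OF zero_le_one rho_ge])
      then show False
        using not_summable_perturb[OF r(2) r(3) c r(5)] by (simp add: a_def rho_def o_def)
    qed
    fix m
    show "sobolev_norm K m f \<le> C * (\<Prod>i<Suc m. a i)"
      unfolding a_def rho_def
    proof (rule geometric_mean_array_bound[of r c C "\<lambda>m j. sobolev_norm K m ((?L ^^ j) f)" m, simplified funpow_0])
      fix m j
      show "sobolev_norm K (Suc (Suc m)) ((?L ^^ j) f)
          \<le> sobolev_norm K m ((?L ^^ Suc j) f) + c * real (Suc m) * sobolev_norm K m ((?L ^^ j) f)"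
        unfolding c_def funpow.simps comp_def by (rule sobolev_norm_two_steps[OF Lf])
      have "(sobolev_norm K (Suc m) ((?L ^^ j) f))\<^sup>2 \<le> sobolev_norm K m ((?L ^^ j) f) *
          (sobolev_norm K m ((?L ^^ Suc j) f) + c * real m * sobolev_norm K m ((?L ^^ j) f))"
        unfolding c_def funpow.simps comp_def by (rule sobolev_norm_one_step[OF Lf])
      also have "\<dots> \<le> sobolev_norm K m ((?L ^^ j) f) *
          (sobolev_norm K m ((?L ^^ Suc j) f) + c * real (Suc m) * sobolev_norm K m ((?L ^^ j) f))"
        using c by (intro mult_left_mono mult_right_mono add_left_mono sobolev_norm_nonneg) auto
      finally show "(sobolev_norm K (Suc m) ((?L ^^ j) f))\<^sup>2 \<le> sobolev_norm K m ((?L ^^ j) f) *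
          (sobolev_norm K m ((?L ^^ Suc j) f) + c * real (Suc m) * sobolev_norm K m ((?L ^^ j) f))" .
    qed (use r c in \<open>auto simp: sobolev_norm_nonneg simp del: sobolev_norm.simps(2)\<close>)
  qed fact
qed

text \<open>Bang's theorem for the functions \<open>t \<mapsto> D\<^sub>b\<^sup>j D\<^sub>v\<^sub>s f (w + t b)\<close>, multiplied by the gauge phase. Their sup norms are
  controlled by Sobolev seminorms of order at most \<open>j + DIM('a) + length vs\<close>, so the sequence \<open>a\<close> enters
  with the fixed shift \<open>p\<close>.\<close>
lemma flat_along_line:
  fixes f :: "'a::euclidean_space \<Rightarrow> complex"
  assumes f: "sobolev_smooth K f"
    and a: "0 \<le> C" "\<And>i. 1 \<le> a i" "incseq a" "\<not> summable (\<lambda>i. 1 / a i)"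
    and growth: "\<And>m. sobolev_norm K m f \<le> C * (\<Prod>i<Suc m. a i)"
    and flat: "\<And>vs. set vs \<subseteq> Basis \<Longrightarrow> foldr (magnetic_deriv K) vs f w = 0"
    and b: "b \<in> Basis" and vs: "set vs \<subseteq> Basis"
  shows "foldr (magnetic_deriv K) vs f (w + t *\<^sub>R b) = 0"
proof -
  define W where "W j = foldr (magnetic_deriv K) (replicate j b @ vs) f" for j
  have words: "set (replicate j b @ vs) \<subseteq> Basis" for j using b vs by (auto simp: set_replicate_conv_if)
  have "sobolev_smooth K (foldr (magnetic_deriv K) us f)" if "set us \<subseteq> Basis" for us
    using that by (induction us) (auto intro: sobolev_smooth_deriv f)
  then have W: "sobolev_smooth K (W j)" for j unfolding W_def using words by blast
  define p where "p = Suc (DIM('a) + length vs)"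
  define C' where "C' = 2 ^ DIM('a) * (C * (\<Prod>i<p. a i))"
  have prod_mono: "(\<Prod>i<m. a i) \<le> (\<Prod>i<n. a i)" if "m \<le> n" for m n
    using that a(2) by (intro prod_mono2) (auto intro: order_trans[OF zero_le_one])
  have bound: "cmod (W j z) \<le> C' * (\<Prod>i<j. a (i + p))" for j z
  proof -
    have "cmod (W j z) \<le> 2 ^ DIM('a) * (C * (\<Prod>i<j + p. a i))"
    proof (rule magnetic_sobolev_embedding[OF W])
      fix i assume i: "i \<le> DIM('a)"
      have "sobolev_norm K i (W j) \<le> sobolev_norm K (i + length (replicate j b @ vs)) f"
        unfolding W_def by (rule sobolev_norm_word[OF words])
      also have "\<dots> \<le> C * (\<Prod>i<Suc (i + length (replicate j b @ vs)). a i)" by (rule growth)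
      also have "\<dots> \<le> C * (\<Prod>i<j + p. a i)"
        using i a(1) by (intro mult_left_mono prod_mono) (auto simp: p_def)
      finally show "sobolev_norm K i (W j) \<le> C * (\<Prod>i<j + p. a i)" .
    qed
    also have "(\<Prod>i<j + p. a i) = (\<Prod>i<p. a i) * (\<Prod>i<j. a (i + p))"
      by (induction j) (simp_all add: mult_ac)
    finally show ?thesis by (simp add: C'_def mult_ac)
  qed
  define phase where "phase s = cis (s * (w \<bullet> K b) + s\<^sup>2 / 2 * (b \<bullet> K b))" for s
  have "phase t * W 0 (w + t *\<^sub>R b) = 0"
  proof (rule bang_uniqueness[of "\<lambda>j s. phase s * W j (w + s *\<^sub>R b)" C' "\<lambda>i. a (i + p)" t])
    fix j s
    show "((\<lambda>s. phase s * W j (w + s *\<^sub>R b)) has_vector_derivative phase s * W (Suc j) (w + s *\<^sub>R b)) (at s)"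
      unfolding phase_def using gauge_has_derivative[OF sobolev_smoothD(1)[OF W] b, of w K j s] by (simp add: W_def)
    show "norm (phase s * W j (w + s *\<^sub>R b)) \<le> C' * (\<Prod>i<j. a (i + p))"
      using bound by (simp add: phase_def norm_mult)
    show "phase 0 * W j (w + 0 *\<^sub>R b) = 0"
      using flat[OF words] by (simp add: W_def)
    show "0 < a (j + p)" using a(2)[of "j + p"] by linarith
    show "incseq (\<lambda>i. a (i + p))" using a(3) by (simp add: incseq_def)
    show "\<not> summable (\<lambda>i. 1 / a (i + p))" using a(4) summable_iff_shift[of "\<lambda>i. 1 / a i" p] by simp
  qed
  then show ?thesis by (simp add: phase_def W_def)
qed

text \<open>Chernoff's theorem for an arbitrary constant magnetic field on a Euclidean space. Flatness travels from
  \<open>w\<close> to \<open>z\<close> along the edges of a box with sides parallel to the axes; for this \<open>flat_along_line\<close> has to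
  be applied to all magnetic derivatives of \<open>f\<close>, not only to \<open>f\<close>.\<close>
theorem magnetic_chernoff:
  fixes f :: "'a::euclidean_space \<Rightarrow> complex"
  assumes f: "smooth f"
    and L2: "\<And>m. in_L2 ((magnetic_laplacian K ^^ m) f)"
    and diverge: "(\<Sum>m. inverse (ennreal (L2_norm ((magnetic_laplacian K ^^ Suc m) f) powr (1 / (2 * real (Suc m)))))) = \<infinity>"
    and flat: "\<And>vs. set vs \<subseteq> Basis \<Longrightarrow> iterated_partial vs f w = 0"
  shows "f z = 0"
proof -
  have "smooth ((magnetic_laplacian K ^^ k) f)" for k
    by (induction k) (auto intro: f smooth_magnetic_laplacian)
  from magnetic_elliptic_regularity[OF this L2, of _ 0]
  have sf: "sobolev_smooth K f" by (simp add: sobolev_smooth_def)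
  obtain C a where a: "0 \<le> C" "\<And>i. 1 \<le> a i" "incseq a" "\<not> summable (\<lambda>i. 1 / a i)"
    "\<And>m. sobolev_norm K m f \<le> C * (\<Prod>i<Suc m. a i)"
    using sobolev_norm_growth[OF sf diverge] by blast
  have flat_w: "foldr (magnetic_deriv K) vs f w = 0" if "set vs \<subseteq> Basis" for vs
    using flat f that by (intro flat_at_imp_magnetic_flat) (auto simp: flat_at_def)
  have "foldr (magnetic_deriv K) vs f (w + (\<Sum>b\<in>B. ((z - w) \<bullet> b) *\<^sub>R b)) = 0"
    if "finite B" "B \<subseteq> Basis" "set vs \<subseteq> Basis" for B vs
    using that
  proof (induction B arbitrary: vs)
    case empty
    then show ?case using flat_w by simp
  next
    case (insert b B)
    have "foldr (magnetic_deriv K) vs f (w + (\<Sum>b\<in>B. ((z - w) \<bullet> b) *\<^sub>R b) + ((z - w) \<bullet> b) *\<^sub>R b) = 0"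
      using insert by (intro flat_along_line[OF sf a]) auto
    then show ?case using insert by (simp add: algebra_simps)
  qed
  from this[OF finite_Basis order_refl, of "[]"] show ?thesis
    by (simp add: euclidean_representation)
qed

theorem theorem1p7:
  fixes l :: real
    and f :: "complex ^ 'n::finite \<Rightarrow> complex"
    and w :: "complex ^ 'n"
  assumes "smooth f"
    and "\<And>m::nat. in_L2 ((special_hermite l ^^ m) f)"
    and "(\<Sum>m. carleman_term l f (Suc m)) = \<infinity>"
    and "\<And>vs. set vs \<subseteq> Basis \<Longrightarrow> iterated_partial vs f w = 0"
  shows "\<forall>z. f z = 0"
proof
  fix z
  let ?L = "magnetic_laplacian (heisenberg_potential l)"
  have powers: "smooth ((?L ^^ m) f) \<and> (special_hermite l ^^ m) f = (?L ^^ m) f" for m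
    by (induction m) (auto simp: assms(1) special_hermite_eq_magnetic intro: smooth_magnetic_laplacian)
  show "f z = 0"
  proof (rule magnetic_chernoff[OF assms(1) _ _ assms(4)])
    show "in_L2 ((?L ^^ m) f)" for m using assms(2)[of m] powers[of m] by simp
    show "(\<Sum>m. inverse (ennreal (L2_norm ((?L ^^ Suc m) f) powr (1 / (2 * real (Suc m)))))) = \<infinity>"
      using assms(3) powers unfolding carleman_term_def by (simp del: funpow.simps of_nat_Suc)
  qed
qed

end
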